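(* Let $A$ be a real $m\times n$ matrix and $S$ an $n\times n$ switching-cost matrix. There exist $K\in\mathbb{N}$ and $0=c_0<c_1<\dots<c_K<c_{K+1}=\infty$ such that for each $i\in\{0,\dots,K\}$ there exists a stationary strategy $\tau_i$ of Player 2, not depending on $c$, which is optimal for Player 2 in the game with switching costs $(A,S,c)$ for every finite $c\in[c_i,c_{i+1}]$.
   Context: A zero-sum game with switching costs is a tuple $(A,S,c)$ where $A=(a_{ij})$ is a real $m\times n$ matrix, $c\ge 0$, and $S=(s_{kj})$ is an $n\times n$ matrix (a switching-cost matrix) with $s_{kj}\ge 0$, $s_{jj}=0$ for all $k,j$, normalized so that its smallest nonzero entry is $1$. At each stage $t=1,2,\dots$, Player 1 (the maximizer) chooses a row $i(t)\in\{1,\dots,m\}$ and Player 2 (the minimizer) simultaneously chooses a column $j(t)\in\{1,\dots,n\}$, possibly at random, knowing the history of realized actions. The stage payoff, paid by Player 2 to Player 1, is $u_t=a_{i(t)j(t)}+c\,s_{j(t-1)j(t)}$, with no switching cost paid at $t=1$. For a strategy pair $(\sigma,\tau)$ the payoff is $\gamma_c(\sigma,\tau)=\mathbb{E}_{\sigma,\tau}\big(\liminf_{T\to\infty}\frac1T\sum_{t=1}^T u_t\big)$. A stationary strategy is a strategy in which the mixed action at stage $t$ depends only on the previous action $j(t-1)$ of Player 2, i.e. it is a vector of $n$ mixed actions, one for each $j(t-1)\in\{1,\dots,n\}$ (at stage 1 a fixed arbitrary initial state $j(0)$ plays the role of the previous action). The game has a value $v(c)$, attained by stationary strategies of both players;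 a strategy $\tau$ of Player 2 is optimal in $(A,S,c)$ if $\gamma_c(\sigma,\tau)\le v(c)$ for every strategy $\sigma$ of Player 1. *)

theory Defs
  imports "HOL-Probability.Probability"
begin

text \<open>
  A history is the list of realized action pairs \<^term>\<open>(i, j)\<close>, oldest first; a play is an infinite
  sequence of such pairs.  Stages are numbered from 0 here, so \<^term>\<open>\<omega> t\<close> is the pair played at
  stage \<open>t + 1\<close> in the usual numbering.
\<close>

type_synonym ('m, 'n) history = "('m \<times> 'n) list"
type_synonym ('m, 'n) play = "nat \<Rightarrow> 'm \<times> 'n"
type_synonym ('m, 'n) strategy1 = "('m, 'n) history \<Rightarrow> 'm pmf"
type_synonym ('m, 'n) strategy2 = "('m, 'n) history \<Rightarrow> 'n pmf"

definition switching_cost_matrix :: "real^'n^'n \<Rightarrow> bool" where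
  "switching_cost_matrix S \<longleftrightarrow>
     (\<forall>k j. 0 \<le> S $ k $ j) \<and> (\<forall>j. S $ j $ j = 0) \<and>
     ({S $ k $ j | k j. S $ k $ j \<noteq> 0} \<noteq> {} \<longrightarrow> Min {S $ k $ j | k j. S $ k $ j \<noteq> 0} = 1)"

definition stage_payoff :: "real^'n^'m \<Rightarrow> real^'n^'n \<Rightarrow> real \<Rightarrow> ('m, 'n) play \<Rightarrow> nat \<Rightarrow> real" where
  "stage_payoff A S c \<omega> t =
     A $ fst (\<omega> t) $ snd (\<omega> t) + (if t = 0 then 0 else c * S $ snd (\<omega> (t - 1)) $ snd (\<omega> t))"

text \<open>
  The law of the play: given the history, the players randomize independently; the
  Ionescu-Tulcea theorem extends this to infinite plays.
\<close>

definition stage_kernel ::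
    "('m, 'n) strategy1 \<Rightarrow> ('m, 'n) strategy2 \<Rightarrow> nat \<Rightarrow> ('m, 'n) play \<Rightarrow> ('m \<times> 'n) measure" where
  "stage_kernel \<sigma> \<tau> t \<omega> =
     measure_pmf (pair_pmf (\<sigma> (map \<omega> [0..<t])) (\<tau> (map \<omega> [0..<t])))"

definition play_measure ::
    "('m, 'n) strategy1 \<Rightarrow> ('m, 'n) strategy2 \<Rightarrow> ('m, 'n) play measure" where
  "play_measure \<sigma> \<tau> =
     projective_family.lim UNIV
       (Ionescu_Tulcea.CI (stage_kernel \<sigma> \<tau>) (\<lambda>_. count_space UNIV)) (\<lambda>_. count_space UNIV)"

text \<open>
  The lower limit is taken in \<^typ>\<open>ereal\<close>; it is finite because stage payoffs are bounded.
\<close>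

definition liminf_average :: "real^'n^'m \<Rightarrow> real^'n^'n \<Rightarrow> real \<Rightarrow> ('m, 'n) play \<Rightarrow> real" where
  "liminf_average A S c \<omega> =
     real_of_ereal (liminf (\<lambda>T. ereal ((\<Sum>t<T. stage_payoff A S c \<omega> t) / real T)))"

definition payoff ::
    "real^'n^'m \<Rightarrow> real^'n^'n \<Rightarrow> real \<Rightarrow> ('m, 'n) strategy1 \<Rightarrow> ('m, 'n) strategy2 \<Rightarrow> real" where
  "payoff A S c \<sigma> \<tau> = (\<integral>\<omega>. liminf_average A S c \<omega> \<partial>play_measure \<sigma> \<tau>)"

definition has_value :: "real^'n^'m \<Rightarrow> real^'n^'n \<Rightarrow> real \<Rightarrow> real \<Rightarrow> bool" where
  "has_value A S c v \<longleftrightarrow>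
     (SUP \<sigma>. INF \<tau>. payoff A S c \<sigma> \<tau>) = v \<and> (INF \<tau>. SUP \<sigma>. payoff A S c \<sigma> \<tau>) = v"

definition optimal2 :: "real^'n^'m \<Rightarrow> real^'n^'n \<Rightarrow> real \<Rightarrow> ('m, 'n) strategy2 \<Rightarrow> bool" where
  "optimal2 A S c \<tau> \<longleftrightarrow> (\<exists>v. has_value A S c v \<and> (\<forall>\<sigma>. payoff A S c \<sigma> \<tau> \<le> v))"

definition previous_column :: "'n \<Rightarrow> ('m, 'n) history \<Rightarrow> 'n" where
  "previous_column j0 h = (if h = [] then j0 else snd (last h))"

text \<open>
  A stationary strategy consists of one mixed action per previous column; \<^term>\<open>j0\<close> is the
  fixed initial state used at the first stage.
\<close>

definition stationary :: "'n \<Rightarrow> (('m, 'n) history \<Rightarrow> 'a pmf) \<Rightarrow> bool" where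
  "stationary j0 \<sigma> \<longleftrightarrow> (\<exists>x :: 'n \<Rightarrow> 'a pmf. \<forall>h. \<sigma> h = x (previous_column j0 h))"


text \<open>
  The rest checks that these notions are well defined: the law exists and gives each finite history
  its intended probability, and the payoff is a bounded integral of an integrable function (so that
  the suprema and infima above are those of nonempty bounded sets of reals).
\<close>

lemma Ionescu_Tulcea_stage_kernel:
  fixes \<sigma> :: "('m::finite, 'n::finite) strategy1" and \<tau> :: "('m, 'n) strategy2"
  shows "Ionescu_Tulcea (stage_kernel \<sigma> \<tau>) (\<lambda>_. count_space UNIV)"
proof (rule Ionescu_Tulcea.intro)
  fix i :: nat
  have "PiM {0..<i} (\<lambda>_. count_space (UNIV :: ('m \<times> 'n) set)) = count_space (PiE {0..<i} (\<lambda>_. UNIV))"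
    by (rule count_space_PiM_finite) auto
  moreover have "stage_kernel \<sigma> \<tau> i \<omega> \<in> space (subprob_algebra (count_space UNIV))" for \<omega>
    by (auto simp: stage_kernel_def space_subprob_algebra
             intro: prob_space_imp_subprob_space measure_pmf.prob_space_axioms)
  ultimately show "stage_kernel \<sigma> \<tau> i
      \<in> PiM {0..<i} (\<lambda>_. count_space UNIV) \<rightarrow>\<^sub>M subprob_algebra (count_space UNIV)"
    by auto
next
  fix i :: nat and \<omega> :: "('m, 'n) play"
  show "prob_space (stage_kernel \<sigma> \<tau> i \<omega>)"
    unfolding stage_kernel_def by (rule measure_pmf.prob_space_axioms)
qed

lemma
  fixes \<sigma> :: "('m::finite, 'n::finite) strategy1" and \<tau> :: "('m, 'n) strategy2"
  shows sets_play_measure: "sets (play_measure \<sigma> \<tau>) = sets (PiM UNIV (\<lambda>_. count_space UNIV))"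
    and space_play_measure: "space (play_measure \<sigma> \<tau>) = UNIV"
    and prob_space_play_measure: "prob_space (play_measure \<sigma> \<tau>)"
proof -
  interpret Ionescu_Tulcea "stage_kernel \<sigma> \<tau>" "\<lambda>_. count_space UNIV"
    by (rule Ionescu_Tulcea_stage_kernel)
  show "sets (play_measure \<sigma> \<tau>) = sets (PiM UNIV (\<lambda>_. count_space UNIV))"
    unfolding play_measure_def by (rule PF.sets_lim)
  show space: "space (play_measure \<sigma> \<tau>) = UNIV"
    unfolding play_measure_def by (simp add: space_PiM)
  have "distr (play_measure \<sigma> \<tau>) (PiM {} (\<lambda>_. count_space UNIV)) (\<lambda>x. restrict x {}) = CI {}"
    unfolding play_measure_def by (rule distr_lim) simp
  moreover have "prob_space (CI {})" by (rule PF.prob_space_P) simp_all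
  moreover have "(\<lambda>x. restrict x ({} :: nat set)) \<in> play_measure \<sigma> \<tau> \<rightarrow>\<^sub>M PiM {} (\<lambda>_. count_space UNIV)"
    unfolding measurable_cong_sets[OF \<open>sets (play_measure \<sigma> \<tau>) = _\<close> refl]
    by (rule measurable_restrict_subset) simp
  ultimately show "prob_space (play_measure \<sigma> \<tau>)"
    by (metis prob_space_distrD)
qed

lemma emeasure_play_measure_cylinder:
  fixes \<sigma> :: "('m::finite, 'n::finite) strategy1" and \<tau> :: "('m, 'n) strategy2"
  shows "emeasure (play_measure \<sigma> \<tau>) {\<omega>. map \<omega> [0..<length h] = h} =
    ennreal (\<Prod>t<length h. pmf (\<sigma> (take t h)) (fst (h ! t)) * pmf (\<tau> (take t h)) (snd (h ! t)))"
proof -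
  interpret Ionescu_Tulcea "stage_kernel \<sigma> \<tau>" "\<lambda>_. count_space UNIV"
    by (rule Ionescu_Tulcea_stage_kernel)
  let ?M = "\<lambda>_::nat. count_space (UNIV :: ('m \<times> 'n) set)"
  have PiM: "PiM {0..<n} ?M = count_space (PiE {0..<n} (\<lambda>_. UNIV))" for n
    by (rule count_space_PiM_finite) auto
  define r where "r n = restrict (\<lambda>t. h ! t) {0..<n}" for n
  have r_in: "r n \<in> space (PiM {0..<n} ?M)" for n
    by (simp add: r_def space_PiM)
  have r_map: "map (r n) [0..<n] = take n h" if "n \<le> length h" for n
    using that by (intro nth_equalityI) (auto simp: r_def)
  have sing: "{r n} \<in> sets (PiM {0..<n} ?M)" for n
    unfolding PiM by (auto simp: r_def)
  have C_r: "emeasure (C 0 n (\<lambda>_. undefined)) {r n} =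
      ennreal (\<Prod>t<n. pmf (\<sigma> (take t h)) (fst (h ! t)) * pmf (\<tau> (take t h)) (snd (h ! t)))"
    if "n \<le> length h" for n
    using that
  proof (induction n)
    case 0
    have "{r 0} = {\<lambda>_. undefined}" by (auto simp: r_def)
    then show ?case by (simp add: PiM_empty)
  next
    case (Suc n)
    let ?p = "pmf (\<sigma> (take n h)) (fst (h ! n)) * pmf (\<tau> (take n h)) (snd (h ! n))"
    have u: "(\<lambda>_. undefined) \<in> space (PiM {0..<0} ?M)" by simp
    have eP: "emeasure (eP n \<omega>) {r (Suc n)} = ennreal ?p * indicator {r n} \<omega>"
      if \<omega>: "\<omega> \<in> space (PiM {0..<n} ?M)" for \<omega>
    proof -
      have *: "(fun_upd \<omega> n x = r (Suc n)) \<longleftrightarrow> \<omega> = r n \<and> x = h ! n" for x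
      proof
        assume eq: "fun_upd \<omega> n x = r (Suc n)"
        have "\<omega> t = r n t" for t
          using fun_cong[OF eq, of t] \<omega>
          by (cases t n rule: linorder_cases) (auto simp: r_def space_PiM PiE_iff extensional_def)
        moreover have "x = h ! n" using fun_cong[OF eq, of n] by (simp add: r_def)
        ultimately show "\<omega> = r n \<and> x = h ! n" by auto
      qed (auto simp: r_def fun_eq_iff)
      have "(\<lambda>x. fun_upd \<omega> n x) -` {r (Suc n)} = (if \<omega> = r n then {h ! n} else {})"
        using * by auto
      moreover have "pmf (pair_pmf (\<sigma> (take n h)) (\<tau> (take n h))) (h ! n) = ?p"
        by (cases "h ! n") (simp add: pmf_pair)
      ultimately show ?thesis
        using Suc.prems emeasure_eP[OF \<omega> sing]
        by (simp add: stage_kernel_def r_map emeasure_pmf_single)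
    qed
    have "emeasure (C 0 (Suc n) (\<lambda>_. undefined)) {r (Suc n)} =
        (\<integral>\<^sup>+\<omega>. emeasure (eP n \<omega>) {r (Suc n)} \<partial>C 0 n (\<lambda>_. undefined))"
      using sing[of "Suc n"] measurable_eP[of n]
      by (simp, subst emeasure_bind[where N="PiM {0..<Suc n} ?M"])
         (auto simp: space_C[OF u] measurable_cong_sets[OF sets_C[OF u] refl] space_PiM_empty_iff)
    also have "\<dots> = (\<integral>\<^sup>+\<omega>. ennreal ?p * indicator {r n} \<omega> \<partial>C 0 n (\<lambda>_. undefined))"
      using space_C[OF u, of n] by (intro nn_integral_cong eP) simp
    also have "\<dots> = ennreal ?p * emeasure (C 0 n (\<lambda>_. undefined)) {r n}"
      using sing[of n] sets_C[OF u, of n] by (intro nn_integral_cmult_indicator) simp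
    finally show ?case
      using Suc by (simp add: ennreal_mult[symmetric] prod_nonneg mult.commute)
  qed
  have "map \<omega> [0..<length h] = h \<longleftrightarrow> restrict \<omega> {0..<length h} = r (length h)" for \<omega>
  proof -
    have "map \<omega> [0..<length h] = h \<longleftrightarrow> (\<forall>t<length h. \<omega> t = h ! t)"
      by (subst list_eq_iff_nth_eq) simp
    also have "\<dots> \<longleftrightarrow> (\<forall>t. restrict \<omega> {0..<length h} t = r (length h) t)"
      by (simp add: r_def restrict_def)
    finally show ?thesis by (simp only: fun_eq_iff)
  qed
  then have "{\<omega>. map \<omega> [0..<length h] = h} = PF.emb UNIV {0..<length h} {r (length h)}"
    by (simp add: prod_emb_def space_PiM set_eq_iff)
  then have "emeasure (play_measure \<sigma> \<tau>) {\<omega>. map \<omega> [0..<length h] = h} =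
      emeasure (CI {0..<length h}) {r (length h)}"
    unfolding play_measure_def using sing lim by simp
  also have "\<dots> = emeasure (C 0 (length h) (\<lambda>_. undefined)) {r (length h)}"
    using sing r_in emeasure_CI[OF order_refl sing] by (simp add: prod_emb_id space_PiM)
  finally show ?thesis using C_r by simp
qed

lemma measurable_liminf_average:
  fixes A :: "real^'n^'m"
  shows "liminf_average A S c \<in> borel_measurable (PiM UNIV (\<lambda>_. count_space UNIV))"
proof -
  have [measurable]: "(\<lambda>\<omega>. stage_payoff A S c \<omega> t) \<in> borel_measurable (PiM UNIV (\<lambda>_. count_space UNIV))"
    for t
  proof -
    have "(\<lambda>\<omega>. (\<omega> (t - 1), \<omega> t)) \<in> PiM UNIV (\<lambda>_. count_space (UNIV :: ('m \<times> 'n) set))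
        \<rightarrow>\<^sub>M count_space UNIV \<Otimes>\<^sub>M count_space UNIV"
      by measurable
    then have "(\<lambda>\<omega>. (\<omega> (t - 1), \<omega> t)) \<in> PiM UNIV (\<lambda>_. count_space (UNIV :: ('m \<times> 'n) set))
        \<rightarrow>\<^sub>M count_space UNIV"
      by (simp add: pair_measure_countable)
    from measurable_compose[OF this, of "\<lambda>(x, y). A $ fst y $ snd y
          + (if t = 0 then 0 else c * S $ snd x $ snd y)" borel]
    show ?thesis by (simp add: stage_payoff_def)
  qed
  show ?thesis unfolding liminf_average_def[abs_def] by measurable
qed

lemma liminf_average_bounded:
  fixes A :: "real^'n^'m"
  obtains B where "\<And>\<omega>. \<bar>liminf_average A S c \<omega>\<bar> \<le> B"
proof -
  define B where "B = (\<Sum>i\<in>UNIV. \<Sum>j\<in>UNIV. \<bar>A $ i $ j\<bar>) + (\<Sum>k\<in>UNIV. \<Sum>j\<in>UNIV. \<bar>c * S $ k $ j\<bar>)"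
  have le: "\<bar>f i j\<bar> \<le> (\<Sum>i\<in>UNIV. \<Sum>j\<in>UNIV. \<bar>f i j\<bar>)" for f :: "'a::finite \<Rightarrow> 'b::finite \<Rightarrow> real" and i j
  proof -
    have "\<bar>f i j\<bar> \<le> (\<Sum>j\<in>UNIV. \<bar>f i j\<bar>)" by (rule member_le_sum) auto
    also have "\<dots> \<le> (\<Sum>i\<in>UNIV. \<Sum>j\<in>UNIV. \<bar>f i j\<bar>)" 
      by (rule member_le_sum[of i UNIV "\<lambda>i. \<Sum>j\<in>UNIV. \<bar>f i j\<bar>"]) (auto intro: sum_nonneg)
    finally show ?thesis .
  qed
  have B0: "0 \<le> B" by (auto simp: B_def intro!: add_nonneg_nonneg sum_nonneg)
  have st: "\<bar>stage_payoff A S c \<omega> t\<bar> \<le> B" for \<omega> t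
    using le[of "\<lambda>i j. A $ i $ j" "fst (\<omega> t)" "snd (\<omega> t)"]
      le[of "\<lambda>i j. c * S $ i $ j" "snd (\<omega> (t - 1))" "snd (\<omega> t)"]
    by (auto simp: stage_payoff_def B_def)
  have av: "\<bar>(\<Sum>t<T. stage_payoff A S c \<omega> t) / real T\<bar> \<le> B" for \<omega> T
  proof (cases "T = 0")
    case False
    have "\<bar>\<Sum>t<T. stage_payoff A S c \<omega> t\<bar> \<le> (\<Sum>t<T. B)"
      by (rule order_trans[OF sum_abs]) (rule sum_mono, rule st)
    then show ?thesis using False by (simp add: field_simps)
  qed (simp add: B0)
  have "\<bar>liminf_average A S c \<omega>\<bar> \<le> B" for \<omega>
  proof -
    let ?L = "liminf (\<lambda>T. ereal ((\<Sum>t<T. stage_payoff A S c \<omega> t) / real T))"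
    have "ereal (- B) \<le> ?L"
      using av[of \<omega>, THEN abs_le_D2]
      by (intro Liminf_bounded always_eventually) (simp add: minus_le_iff)
    moreover have "?L \<le> ereal B"
      using av[of \<omega>, THEN abs_le_D1]
      by (intro order_trans[OF Liminf_le_Limsup Limsup_bounded] always_eventually) simp_all
    ultimately show ?thesis
      unfolding liminf_average_def by (cases ?L) auto
  qed
  then show thesis by (rule that)
qed

lemma integrable_liminf_average:
  fixes A :: "real^'n^'m"
  shows "integrable (play_measure \<sigma> \<tau>) (liminf_average A S c)"
proof -
  interpret prob_space "play_measure \<sigma> \<tau>" by (rule prob_space_play_measure)
  obtain B where "\<And>\<omega>. \<bar>liminf_average A S c \<omega>\<bar> \<le> B"
    using liminf_average_bounded by blast
  then show ?thesis
    using measurable_liminf_average[of A S c]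
    by (intro integrable_const_bound[where B=B])
       (auto simp: measurable_cong_sets[OF sets_play_measure refl])
qed

lemma payoff_bounded:
  fixes A :: "real^'n^'m"
  obtains B where "\<And>\<sigma> \<tau>. \<bar>payoff A S c \<sigma> \<tau>\<bar> \<le> B"
proof -
  obtain B where B: "\<And>\<omega>. \<bar>liminf_average A S c \<omega>\<bar> \<le> B"
    using liminf_average_bounded by blast
  have "\<bar>payoff A S c \<sigma> \<tau>\<bar> \<le> B" for \<sigma> \<tau>
  proof -
    interpret prob_space "play_measure \<sigma> \<tau>" by (rule prob_space_play_measure)
    have int: "integrable (play_measure \<sigma> \<tau>) (liminf_average A S c)"
      by (rule integrable_liminf_average)
    have "payoff A S c \<sigma> \<tau> \<le> B" "- B \<le> payoff A S c \<sigma> \<tau>"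
      unfolding payoff_def using int B
      by (auto intro!: integral_le_const integral_ge_const simp: abs_le_iff minus_le_iff)
    then show ?thesis by auto
  qed
  then show thesis by (rule that)
qed

end

theory Submission
  imports Defs
begin

text \<open>
  Only Player 2 moves the state (the previous column), so a stationary strategy of Player 2 matters
  only through the long-run frequencies \<open>x (k, j)\<close> with which column \<open>k\<close> is followed by column
  \<open>j\<close>.  These frequencies form a circulation of total mass one, a \<^emph>\<open>flow\<close>, and the best reply of
  Player 1 against them costs
  \<open>(\<Sum>k. max\<^sub>i (\<Sum>j. x (k, j) * a\<^sub>i\<^sub>j)) + c * (\<Sum>k. \<Sum>j. x (k, j) * s\<^sub>k\<^sub>j)\<close>.
  The polytope of flows does not depend on \<open>c\<close>, and \<open>c\<close> enters the cost only as the slope of a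
  linear term.  Choosing a maximizing row for each state cuts the polytope into finitely many
  polytopes on which the cost is linear, and their vertices form a finite set of flows that contains
  a minimizer for every \<open>c\<close> (\<open>finite_optimal_flows\<close>).  The minimal cost is therefore the lower
  envelope of finitely many affine functions of \<open>c\<close>, and one flow is optimal on each of its linear
  pieces (\<open>exists_lower_envelope_breakpoints\<close>).

  It remains to see that the minimal cost \<open>V\<close> is the value of the game and that a stationary strategy
  which plays according to an optimal flow guarantees it.  Both bounds are certified by a potential:
  a function \<open>w\<close> of the state such that, after each history, the conditional mean of the stage payoff
  plus the increment of \<open>w\<close> is at least (or at most) \<open>v\<close>.  The increments telescope, and the
  deviations from the conditional means average out almost surely, so the long-run average is
  at least (at most) \<open>v\<close> (\<open>payoff_ge\<close>, \<open>payoff_le\<close>).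

  The potentials come from convex duality.  If no pair of a stationary strategy of Player 1 and a
  potential achieved \<open>v < V\<close>, the normal vector of a separating hyperplane would be a flow of cost at
  most \<open>v\<close> (\<open>flow_dual_potential\<close>).  If no potential kept the drift of Player 2's strategy below some
  \<open>v > V\<close>, the normal vector would be a stationary distribution, of cost at least \<open>v\<close>, of the chain that
  the strategy induces (\<open>policy_potential\<close>).  There is none: a small multiple of that distribution could be subtracted from
  the optimal flow, leaving, after normalization, a flow cheaper than the optimum
  (\<open>stationary_cost_le\<close>).  This argument covers flows that split into several recurrent classes.
\<close>

section \<open>Lower envelopes of finitely many affine functions\<close>

text \<open>
  The breakpoints are the positive points at which two members of the family with different slopes
  cross.  Between two consecutive breakpoints the order of any two members cannot change, so whichever
  member is minimal at one interior point is minimal on the whole closed interval.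
\<close>

lemma exists_lower_envelope_breakpoints:
  fixes p r :: "'a \<Rightarrow> real"
  assumes "finite E" and "E \<noteq> {}"
  shows "\<exists>(K::nat) (c :: nat \<Rightarrow> ereal). c 0 = 0 \<and> c (K + 1) = \<infinity> \<and> (\<forall>i\<le>K. c i < c (i + 1)) \<and>
    (\<forall>i\<le>K. \<exists>e\<in>E. \<forall>x::real. c i \<le> ereal x \<and> ereal x \<le> c (i + 1) \<longrightarrow>
       (\<forall>e'\<in>E. p e + x * r e \<le> p e' + x * r e'))"
proof -
  define X where "X = {x. 0 < x \<and> (\<exists>e\<in>E. \<exists>e'\<in>E. r e \<noteq> r e' \<and> p e + x * r e = p e' + x * r e')}"
  have "X \<subseteq> (\<lambda>(e, e'). (p e' - p e) / (r e - r e')) ` (E \<times> E)"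
    by (force simp: X_def image_iff field_simps)
  then have "finite X" using \<open>finite E\<close> finite_subset by blast
  define L where "L = sorted_list_of_set X"
  define K where "K = length L"
  have set_L: "set L = X" and "sorted_wrt (<) L"
    using \<open>finite X\<close> by (auto simp: L_def)
  define c where "c i = (if i = 0 then 0 else if i \<le> K then ereal (L ! (i - 1)) else \<infinity>)" for i
  have L_pos: "0 < L ! i" if "i < K" for i
    using that set_L nth_mem[of i L] by (auto simp: K_def X_def)
  have c_less: "c i < c (i + 1)" if "i \<le> K" for i
    using that L_pos[of 0] sorted_wrt_nth_less[OF \<open>sorted_wrt (<) L\<close>, of "i - 1" i]
    by (cases "i = 0") (auto simp: c_def K_def Suc_le_eq)
  \<comment> \<open>a crossing in an open piece would be a list entry strictly between two neighbours\<close>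
  have no_crossing: "x \<notin> X" if "i \<le> K" and "c i < ereal x" and "ereal x < c (i + 1)" for i x
  proof
    assume "x \<in> X"
    then obtain l where "l < K" and x: "x = L ! l" using set_L by (auto simp: K_def in_set_conv_nth)
    have mono: "L ! a \<le> L ! b" if "a \<le> b" "b < K" for a b
      using that sorted_wrt_nth_less[OF \<open>sorted_wrt (<) L\<close>, of a b] by (cases "a = b") (auto simp: K_def)
    show False
    proof (cases "l < i")
      case True
      then have "l \<le> i - 1" "i - 1 < K" using \<open>i \<le> K\<close> by auto
      then show False using mono[of l "i - 1"] that x True by (auto simp: c_def)
    next
      case False
      then show False using mono[of i l] that x \<open>l < K\<close> by (auto simp: c_def)
    qed
  qed
  have "\<exists>e\<in>E. \<forall>x::real. c i \<le> ereal x \<and> ereal x \<le> c (i + 1) \<longrightarrow>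
       (\<forall>e'\<in>E. p e + x * r e \<le> p e' + x * r e')" if "i \<le> K" for i
  proof -
    have "c i < c (i + 1)" using c_less that .
    then obtain m where m: "c i < ereal m" "ereal m < c (i + 1)"
      using ereal_dense2 by blast
    have "0 \<le> c i" using L_pos[of "i - 1"] that by (cases i) (auto simp: c_def less_imp_le)
    define e where "e = arg_min_on (\<lambda>e. p e + m * r e) E"
    have "e \<in> E" unfolding e_def by (rule arg_min_if_finite(1)[OF assms])
    have e: "p e + m * r e \<le> p e' + m * r e'" if "e' \<in> E" for e'
      unfolding e_def by (rule arg_min_least[OF assms that])
    have "p e + x * r e \<le> p e' + x * r e'"
      if x: "c i \<le> ereal x" "ereal x \<le> c (i + 1)" and "e' \<in> E" for x e'
    proof (rule ccontr)
      assume "\<not> ?thesis"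
      then have gt: "p e' + x * r e' < p e + x * r e" by simp
      define d where "d = r e' - r e"
      define y where "y = (p e - p e') / d"
      have em: "p e - p e' \<le> m * d" and ex: "x * d < p e - p e'"
        using e[OF \<open>e' \<in> E\<close>] gt by (auto simp: d_def algebra_simps)
      have "d \<noteq> 0" using em ex by auto
      \<comment> \<open>the crossing lies between the sample point and the point of failure\<close>
      have y: "c i < ereal y \<and> ereal y < c (i + 1)"
      proof (cases "0 < d")
        case True
        then have "x < y" "y \<le> m" using em ex by (auto simp: y_def field_simps)
        then have "ereal x < ereal y" "ereal y \<le> ereal m" by auto
        then show ?thesis using x m by (meson order.strict_trans1)
      next
        case False
        then have "d < 0" using \<open>d \<noteq> 0\<close> by simp
        then have "y < x" "m \<le> y" using em ex by (auto simp: y_def field_simps)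
        then have "ereal y < ereal x" "ereal m \<le> ereal y" by auto
        then show ?thesis using x m by (meson order.strict_trans2)
      qed
      have "0 < ereal y" using y \<open>0 \<le> c i\<close> by (meson order.strict_trans1)
      moreover have "p e + y * r e = p e' + y * r e'"
        using \<open>d \<noteq> 0\<close> by (simp add: y_def d_def field_simps)
      ultimately have "y \<in> X"
        using \<open>e \<in> E\<close> \<open>e' \<in> E\<close> \<open>d \<noteq> 0\<close> by (auto simp: X_def d_def intro!: bexI)
      then show False using no_crossing[OF \<open>i \<le> K\<close>] y by blast
    qed
    then show ?thesis using \<open>e \<in> E\<close> by blast
  qed
  then have "c 0 = 0 \<and> c (K + 1) = \<infinity> \<and> (\<forall>i\<le>K. c i < c (i + 1)) \<and>
    (\<forall>i\<le>K. \<exists>e\<in>E. \<forall>x::real. c i \<le> ereal x \<and> ereal x \<le> c (i + 1) \<longrightarrow>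
       (\<forall>e'\<in>E. p e + x * r e \<le> p e' + x * r e'))"
    using c_less by (simp add: c_def)
  then show ?thesis by blast
qed

section \<open>Duality by separating hyperplanes\<close>

text \<open>
  The theorem of the alternative behind both potentials: a hyperplane that separates \<open>C\<close> from the
  vectors with all entries at least \<open>v\<close> has a nonnegative normal vector, which can be scaled to a
  probability vector and then violates the assumption.
\<close>

lemma convex_dominates_if_no_separating_weight:
  fixes C :: "(real^'k) set"
  assumes "convex C"
    and weight: "\<And>x::real^'k. (\<forall>i. 0 \<le> x $ i) \<Longrightarrow> (\<Sum>i\<in>UNIV. x $ i) = 1 \<Longrightarrow> \<exists>g\<in>C. v < x \<bullet> g"
  shows "\<exists>g\<in>C. \<forall>i. v \<le> g $ i"
proof (rule ccontr)
  assume contra: "\<not> ?thesis"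
  define U where "U = {u::real^'k. \<forall>i. v \<le> u $ i}"
  have "convex U"
  proof (rule convexI)
    fix x y and s t :: real
    assume "x \<in> U" "y \<in> U" "0 \<le> s" "0 \<le> t" "s + t = 1"
    then have "s * v + t * v \<le> s * x $ i + t * y $ i" for i
      by (intro add_mono mult_left_mono) (auto simp: U_def)
    then show "s *\<^sub>R x + t *\<^sub>R y \<in> U"
      using \<open>s + t = 1\<close> by (simp add: U_def distrib_right[symmetric])
  qed
  moreover have "C \<inter> U = {}" using contra by (auto simp: U_def)
  moreover have "C \<noteq> {}"
  proof -
    have "0 \<le> (axis undefined 1 :: real^'k) $ i" for i by (simp add: axis_def)
    moreover have "(\<Sum>i\<in>UNIV. (axis undefined 1 :: real^'k) $ i) = 1" by (simp add: axis_def)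
    ultimately show ?thesis using weight by blast
  qed
  moreover have vU: "(\<chi> i. v) \<in> U" by (simp add: U_def)
  ultimately obtain a b where "a \<noteq> 0" and aC: "\<forall>g\<in>C. a \<bullet> g \<le> b" and aU: "\<forall>u\<in>U. b \<le> a \<bullet> u"
    using separating_hyperplane_sets[of C U] \<open>convex C\<close> by blast
  \<comment> \<open>the second set is unbounded above in every coordinate\<close>
  have a_nonneg: "0 \<le> a $ i" for i
  proof (rule ccontr)
    assume "\<not> 0 \<le> a $ i"
    then have neg: "a $ i < 0" by simp
    define s where "s = max 0 ((b - 1 - a \<bullet> (\<chi> i. v)) / a $ i)"
    have "(\<chi> i. v) + s *\<^sub>R axis i 1 \<in> U"
      by (auto simp: U_def axis_def s_def)
    with aU have "b \<le> a \<bullet> (\<chi> i. v) + s * a $ i"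
      by (force simp: inner_add_right inner_axis)
    moreover have "s * a $ i \<le> (b - 1 - a \<bullet> (\<chi> i. v)) / a $ i * a $ i"
      using neg by (intro mult_right_mono_neg) (auto simp: s_def)
    ultimately show False using neg by simp
  qed
  define A where "A = (\<Sum>i\<in>UNIV. a $ i)"
  have "A \<noteq> 0"
    using \<open>a \<noteq> 0\<close> a_nonneg by (auto simp: A_def sum_nonneg_eq_0_iff vec_eq_iff)
  then have "0 < A" using a_nonneg by (simp add: A_def sum_nonneg order_less_le)
  then obtain g where "g \<in> C" and "v < (a /\<^sub>R A) \<bullet> g"
    using weight[of "a /\<^sub>R A"] a_nonneg
    by (auto simp: A_def sum_divide_distrib[symmetric] divide_inverse_commute[symmetric])
  then have "v * A < a \<bullet> g" using \<open>0 < A\<close> by (simp add: field_simps)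
  also have "\<dots> \<le> b" using aC \<open>g \<in> C\<close> by simp
  also have "\<dots> \<le> a \<bullet> (\<chi> i. v)" using aU vU by simp
  also have "\<dots> = v * A" by (simp add: A_def inner_vec_def sum_distrib_left mult.commute)
  finally show False by simp
qed

text \<open>
  Here \<open>d\<close> is the amount by which a weight fails to be balanced and \<open>w\<close> is a potential.  Potentials range
  over a vector space, so an unbalanced weight is beaten by a large multiple of \<open>d\<close>.
\<close>

lemma exists_multiplier:
  fixes d :: "'k::finite \<Rightarrow> real"
  assumes "(\<forall>j. d j = 0) \<Longrightarrow> v < b"
  shows "\<exists>w. v < b + (\<Sum>j\<in>UNIV. w j * d j)"
proof (cases "\<forall>j. d j = 0")
  case False
  define D where "D = (\<Sum>j\<in>UNIV. d j * d j)"
  have "D \<noteq> 0" using False by (auto simp: D_def sum_nonneg_eq_0_iff)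
  have "(\<Sum>j\<in>UNIV. t * d j * d j) = t * D" for t
    by (simp add: D_def sum_distrib_left mult.assoc)
  from this[of "(v - b + 1) / D"] have "v < b + (\<Sum>j\<in>UNIV. (v - b + 1) / D * d j * d j)"
    using \<open>D \<noteq> 0\<close> by simp
  then show ?thesis by (intro exI[of _ "\<lambda>j. (v - b + 1) / D * d j"])
qed (use assms in auto)

section \<open>Flows and their cost\<close>

definition outflow :: "real^('n::finite \<times> 'n) \<Rightarrow> 'n \<Rightarrow> real" where
  "outflow x k = (\<Sum>j\<in>UNIV. x $ (k, j))"

text \<open>
  The entry \<open>x $ (k, j)\<close> is the long-run frequency of the stages at which column \<open>k\<close> is followed by
  column \<open>j\<close>; each column is left as often as it is entered.
\<close>

definition flows :: "(real^('n::finite \<times> 'n)) set" where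
  "flows = {x. (\<forall>k j. 0 \<le> x $ (k, j)) \<and> (\<forall>j. (\<Sum>k\<in>UNIV. x $ (k, j)) = outflow x j) \<and>
               (\<Sum>k\<in>UNIV. outflow x k) = 1}"

text \<open>
  Player 1 sees the previous column, so a best reply maximizes separately in each state.
\<close>

definition matrix_cost :: "real^'n::finite^'m \<Rightarrow> real^('n \<times> 'n) \<Rightarrow> real" where
  "matrix_cost A x = (\<Sum>k\<in>UNIV. MAX i. \<Sum>j\<in>UNIV. x $ (k, j) * A $ i $ j)"

definition switching_rate :: "real^'n::finite^'n \<Rightarrow> real^('n \<times> 'n) \<Rightarrow> real" where
  "switching_rate S x = (\<Sum>k\<in>UNIV. \<Sum>j\<in>UNIV. x $ (k, j) * S $ k $ j)"

definition flow_cost :: "real^'n::finite^'m \<Rightarrow> real^'n^'n \<Rightarrow> real \<Rightarrow> real^('n \<times> 'n) \<Rightarrow> real" where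
  "flow_cost A S c x = matrix_cost A x + c * switching_rate S x"

lemma sum_UNIV_prod: "(\<Sum>p\<in>UNIV. f p) = (\<Sum>k\<in>UNIV. \<Sum>j\<in>UNIV. f (k, j))"
  for f :: "'a::finite \<times> 'b::finite \<Rightarrow> real"
  by (simp add: sum.cartesian_product UNIV_Times_UNIV[symmetric] del: UNIV_Times_UNIV)

lemma Max_range_attained:
  fixes f :: "'k \<Rightarrow> 'i::finite \<Rightarrow> real"
  obtains \<alpha> where "\<And>k. (MAX i. f k i) = f k (\<alpha> k)"
proof -
  have "\<exists>i. (MAX i. f k i) = f k i" for k
  proof -
    have "Max (range (f k)) \<in> range (f k)" by (rule Max_in) auto
    then show ?thesis by (rule rangeE) blast
  qed
  then show thesis using choice[of "\<lambda>k i. (MAX i. f k i) = f k i"] that by blast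
qed

lemma polyhedron_linear_le:
  fixes f :: "'a::euclidean_space \<Rightarrow> real"
  assumes "linear f"
  shows "polyhedron {x. f x \<le> b}"
proof -
  have "f x = adjoint f 1 \<bullet> x" for x
    using adjoint_works[OF assms, of x 1] by (simp add: inner_commute)
  then show ?thesis using polyhedron_halfspace_le[of "adjoint f 1" b] by simp
qed

lemma polyhedron_all_linear_le:
  fixes f :: "'i::finite \<Rightarrow> 'a::euclidean_space \<Rightarrow> real"
  assumes "\<And>i. linear (f i)"
  shows "polyhedron {x. \<forall>i. f i x \<le> b i}"
proof -
  have "{x. \<forall>i. f i x \<le> b i} = \<Inter>(range (\<lambda>i. {x. f i x \<le> b i}))" by auto
  then show ?thesis using assms by (auto intro!: polyhedron_Inter polyhedron_linear_le)
qed

lemma polytope_linear_min_at_vertex: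
  fixes f :: "'a::euclidean_space \<Rightarrow> real"
  assumes "linear f" and "x \<in> convex hull V"
  shows "\<exists>e\<in>V. f e \<le> f x"
proof (rule ccontr)
  assume "\<not> ?thesis"
  then have "V \<subseteq> f -` {f x<..}" by auto
  moreover have "convex (f -` {f x<..})"
    using assms(1) by (intro convex_linear_vimage) auto
  ultimately have "convex hull V \<subseteq> f -` {f x<..}" by (rule hull_minimal)
  then show False using assms(2) by auto
qed

lemma flows_nonempty: "flows \<noteq> ({} :: (real^('n::finite \<times> 'n)) set)"
proof -
  let ?l = "undefined :: 'n"
  let ?x = "\<chi> p. (if p = (?l, ?l) then 1 else 0 :: real)"
  have "outflow ?x k = (if k = ?l then 1 else 0)" for k
    by (simp add: outflow_def)
  then have "?x \<in> flows" by (auto simp: flows_def)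
  then show ?thesis by blast
qed

text \<open>
  The cost is piecewise linear: on the flows for which a given selection \<open>\<alpha>\<close> of rows is a best reply it is
  linear, and these flows form a polytope that is the same for all \<open>c\<close>.  A minimum over
  a polytope is attained at a vertex, so the vertices for all selections suffice.
\<close>

lemma finite_optimal_flows:
  fixes A :: "real^'n::finite^'m" and S :: "real^'n^'n"
  shows "\<exists>E\<subseteq>flows. finite E \<and> E \<noteq> {} \<and>
    (\<forall>c. \<forall>x\<in>flows. \<exists>e\<in>E. flow_cost A S c e \<le> flow_cost A S c x)"
proof -
  \<comment> \<open>for each choice of a row per state: a linear function, and the flows on which it is the cost\<close>
  define lin where "lin \<alpha> c x = (\<Sum>k\<in>UNIV. \<Sum>j\<in>UNIV. x $ (k, j) * A $ \<alpha> k $ j) + c * switching_rate S x"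
    for \<alpha> :: "'n \<Rightarrow> 'm" and c and x :: "real^('n \<times> 'n)"
  define G where "G \<alpha> = flows \<inter> {x :: real^('n \<times> 'n). \<forall>p.
      (\<Sum>j\<in>UNIV. x $ (fst p, j) * A $ snd p $ j) -
      (\<Sum>j\<in>UNIV. x $ (fst p, j) * A $ \<alpha> (fst p) $ j) \<le> 0}"
    for \<alpha> :: "'n \<Rightarrow> 'm"
  note lin_simps = linear_iff sum.distrib algebra_simps sum_distrib_left outflow_def
  have linear_lin: "linear (lin \<alpha> c)" for \<alpha> c
    by (simp add: lin_def switching_rate_def lin_simps)
  have "bounded (flows :: (real^('n \<times> 'n)) set)"
  proof (rule boundedI)
    fix x :: "real^('n \<times> 'n)" assume "x \<in> flows"
    then have "(\<Sum>p\<in>UNIV. \<bar>x $ p\<bar>) = 1"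
      by (auto simp: flows_def outflow_def sum_UNIV_prod)
    then show "norm x \<le> 1" using norm_le_l1_cart[of x] by simp
  qed
  have "polyhedron (flows :: (real^('n \<times> 'n)) set)"
  proof -
    have "flows = {x :: real^('n \<times> 'n). \<forall>p. - x $ p \<le> 0}
        \<inter> {x. \<forall>j. (\<Sum>k\<in>UNIV. x $ (k, j)) - outflow x j \<le> 0}
        \<inter> {x. \<forall>j. outflow x j - (\<Sum>k\<in>UNIV. x $ (k, j)) \<le> 0}
        \<inter> {x. (\<Sum>k\<in>UNIV. outflow x k) \<le> 1} \<inter> {x. - (\<Sum>k\<in>UNIV. outflow x k) \<le> - 1}"
      by (auto simp: flows_def intro: antisym)
    also have "polyhedron \<dots>"
      by (intro polyhedron_Int polyhedron_all_linear_le polyhedron_linear_le) (simp_all add: lin_simps sum_negf)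
    finally show ?thesis .
  qed
  have "polytope (G \<alpha>)" for \<alpha>
  proof -
    have "polyhedron (G \<alpha>)" unfolding G_def
      by (intro polyhedron_Int polyhedron_all_linear_le \<open>polyhedron flows\<close>) (simp_all add: lin_simps)
    moreover have "bounded (G \<alpha>)"
      using \<open>bounded flows\<close> by (rule bounded_subset) (auto simp: G_def)
    ultimately show ?thesis by (simp add: polytope_eq_bounded_polyhedron)
  qed
  then obtain V where V: "\<And>\<alpha>. finite (V \<alpha>)" "\<And>\<alpha>. G \<alpha> = convex hull V \<alpha>"
    unfolding polytope_def by metis
  have lin_eq: "flow_cost A S c x = lin \<alpha> c x" if "x \<in> G \<alpha>" for x c \<alpha>
  proof -
    have "(MAX i. \<Sum>j\<in>UNIV. x $ (k, j) * A $ i $ j) = (\<Sum>j\<in>UNIV. x $ (k, j) * A $ \<alpha> k $ j)" for k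
      using that by (intro Max_eqI) (auto simp: G_def)
    then show ?thesis by (simp add: flow_cost_def matrix_cost_def lin_def)
  qed
  have cover: "\<exists>\<alpha>. x \<in> G \<alpha>" if "x \<in> flows" for x
  proof -
    obtain \<alpha> where \<alpha>: "\<And>k. (MAX i. \<Sum>j\<in>UNIV. x $ (k, j) * A $ i $ j) = (\<Sum>j\<in>UNIV. x $ (k, j) * A $ \<alpha> k $ j)"
      by (rule Max_range_attained[of "\<lambda>k i. \<Sum>j\<in>UNIV. x $ (k, j) * A $ i $ j"]) blast
    have "(\<Sum>j\<in>UNIV. x $ (k, j) * A $ i $ j) \<le> (\<Sum>j\<in>UNIV. x $ (k, j) * A $ \<alpha> k $ j)" for k i
      unfolding \<alpha>[symmetric] by (rule Max_ge) auto
    then show ?thesis using that by (auto simp: G_def)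
  qed
  define E where "E = (\<Union>\<alpha>. V \<alpha>)"
  have V_G: "V \<alpha> \<subseteq> G \<alpha>" for \<alpha> using V(2) hull_subset by metis
  then have "E \<subseteq> flows" by (auto simp: E_def G_def)
  moreover have "finite E" using V(1) by (simp add: E_def)
  moreover have min: "\<exists>e\<in>E. flow_cost A S c e \<le> flow_cost A S c x" if "x \<in> flows" for c x
  proof -
    obtain \<alpha> where "x \<in> G \<alpha>" using cover \<open>x \<in> flows\<close> by blast
    then obtain e where "e \<in> V \<alpha>" "lin \<alpha> c e \<le> lin \<alpha> c x"
      using polytope_linear_min_at_vertex[OF linear_lin] V(2) by blast
    moreover from this have "e \<in> G \<alpha>" "e \<in> E" using V_G by (auto simp: E_def)
    ultimately show ?thesis using lin_eq \<open>x \<in> G \<alpha>\<close> by metis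
  qed
  moreover have "E \<noteq> {}" using min flows_nonempty by blast
  ultimately show ?thesis by blast
qed

section \<open>Potentials\<close>

text \<open>
  Linear programming duality for the minimum cost of a flow.  The vectors on the right-hand side, for all
  mixed actions \<open>y k\<close> and potentials \<open>w\<close>, form a convex set.  A weight \<open>x\<close> that is not a circulation is
  beaten by choosing \<open>w\<close>; a flow is beaten by best replies, whose average against \<open>x\<close> is its cost.
\<close>

lemma flow_dual_potential:
  fixes A :: "real^'n::finite^'m" and S :: "real^'n^'n"
  assumes "\<And>x. x \<in> flows \<Longrightarrow> v < flow_cost A S c x"
  shows "\<exists>(y :: 'n \<Rightarrow> 'm pmf) w. \<forall>k j.
    v \<le> (\<Sum>i\<in>UNIV. pmf (y k) i * A $ i $ j) + c * S $ k $ j + w j - w k"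
proof -
  define g where "g y w = (\<chi> p. (\<Sum>i\<in>UNIV. y (fst p) i * A $ i $ snd p) + c * S $ fst p $ snd p + w (snd p) - w (fst p))"
    for y :: "'n \<Rightarrow> 'm \<Rightarrow> real" and w :: "'n \<Rightarrow> real"
  define C where "C = {g y w | y w. (\<forall>k i. 0 \<le> y k i) \<and> (\<forall>k. (\<Sum>i\<in>UNIV. y k i) = 1)}"
  have "convex C"
  proof (rule convexI)
    fix a b and s t :: real
    assume st: "0 \<le> s" "0 \<le> t" "s + t = 1" and "a \<in> C" "b \<in> C"
    then obtain y w y' w' where a: "a = g y w" "\<And>k i. 0 \<le> y k i" "\<And>k. (\<Sum>i\<in>UNIV. y k i) = 1"
      and b: "b = g y' w'" "\<And>k i. 0 \<le> y' k i" "\<And>k. (\<Sum>i\<in>UNIV. y' k i) = 1"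
      by (auto simp: C_def)
    have t: "t = 1 - s" using st by simp
    have "s *\<^sub>R a + t *\<^sub>R b = g (\<lambda>k i. s * y k i + t * y' k i) (\<lambda>k. s * w k + t * w' k)"
      unfolding a b g_def vec_eq_iff t
      by (simp add: sum.distrib sum_subtractf sum_distrib_left algebra_simps)
    then show "s *\<^sub>R a + t *\<^sub>R b \<in> C"
      unfolding C_def using st a b
      by (auto simp: sum.distrib sum_distrib_left[symmetric] intro!: exI)
  qed
  moreover have "\<exists>g\<in>C. v < x \<bullet> g"
    if x: "\<forall>p. 0 \<le> x $ p" "(\<Sum>p\<in>UNIV. x $ p) = 1" for x :: "real^('n \<times> 'n)"
  proof -
    obtain \<alpha> where \<alpha>: "\<And>k. (MAX i. \<Sum>j\<in>UNIV. x $ (k, j) * A $ i $ j) = (\<Sum>j\<in>UNIV. x $ (k, j) * A $ \<alpha> k $ j)"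
      by (rule Max_range_attained[of "\<lambda>k i. \<Sum>j\<in>UNIV. x $ (k, j) * A $ i $ j"]) blast
    define y where "y = (\<lambda>k i. if i = \<alpha> k then 1 else 0 :: real)"
    have y_sum: "(\<Sum>i\<in>UNIV. y k i * A $ i $ j) = A $ \<alpha> k $ j" for k j
      by (simp add: y_def if_distrib[of "\<lambda>t. t * _"] cong: if_cong)
    have inner: "x \<bullet> g y w = flow_cost A S c x + (\<Sum>j\<in>UNIV. w j * ((\<Sum>k\<in>UNIV. x $ (k, j)) - outflow x j))" for w
    proof -
      have "(\<Sum>k\<in>UNIV. \<Sum>j\<in>UNIV. x $ (k, j) * w j) = (\<Sum>j\<in>UNIV. w j * (\<Sum>k\<in>UNIV. x $ (k, j)))"
        by (subst sum.swap) (simp add: sum_distrib_left mult.commute)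
      moreover have "(\<Sum>k\<in>UNIV. \<Sum>j\<in>UNIV. x $ (k, j) * w k) = (\<Sum>j\<in>UNIV. w j * outflow x j)"
        by (simp add: outflow_def sum_distrib_left mult.commute)
      moreover have "x \<bullet> g y w = (\<Sum>k\<in>UNIV. \<Sum>j\<in>UNIV. x $ (k, j) * A $ \<alpha> k $ j) + c * switching_rate S x
          + (\<Sum>k\<in>UNIV. \<Sum>j\<in>UNIV. x $ (k, j) * w j) - (\<Sum>k\<in>UNIV. \<Sum>j\<in>UNIV. x $ (k, j) * w k)"
        by (simp add: inner_vec_def sum_UNIV_prod g_def y_sum switching_rate_def
            sum.distrib sum_subtractf sum_distrib_left algebra_simps)
      ultimately show ?thesis
        by (simp add: flow_cost_def matrix_cost_def \<alpha> right_diff_distrib sum_subtractf)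
    qed
    have "\<exists>w. v < flow_cost A S c x + (\<Sum>j\<in>UNIV. w j * ((\<Sum>k\<in>UNIV. x $ (k, j)) - outflow x j))"
    proof (rule exists_multiplier)
      assume "\<forall>j. (\<Sum>k\<in>UNIV. x $ (k, j)) - outflow x j = 0"
      then have "x \<in> flows" using x by (simp add: flows_def sum_UNIV_prod outflow_def)
      then show "v < flow_cost A S c x" by (rule assms)
    qed
    then obtain w where "v < flow_cost A S c x + (\<Sum>j\<in>UNIV. w j * ((\<Sum>k\<in>UNIV. x $ (k, j)) - outflow x j))"
      by blast
    moreover have "\<forall>k i. 0 \<le> y k i" "\<forall>k. (\<Sum>i\<in>UNIV. y k i) = 1" by (simp_all add: y_def)
    then have "g y w \<in> C" unfolding C_def by blast
    ultimately show ?thesis using inner[of w] by (intro bexI[of _ "g y w"]) simp_all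
  qed
  ultimately obtain y w where y: "\<And>k i. 0 \<le> y k i" "\<And>k. (\<Sum>i\<in>UNIV. y k i) = 1"
    and vg: "\<forall>p. v \<le> g y w $ p"
    using convex_dominates_if_no_separating_weight[of C v] by (auto simp: C_def)
  \<comment> \<open>the separation argument works with vectors; they are turned into probability mass functions here\<close>
  define q where "q k = embed_pmf (y k)" for k
  have pmf_q: "pmf (q k) i = y k i" for k i
    unfolding q_def using y
    by (intro pmf_embed_pmf) (auto simp: nn_integral_count_space_finite sum_ennreal)
  then have "\<forall>k j. v \<le> (\<Sum>i\<in>UNIV. pmf (q k) i * A $ i $ j) + c * S $ k $ j + w j - w k"
    using vg by (simp add: g_def)
  then show ?thesis by blast
qed

text \<open>
  The first condition fixes \<open>z k\<close> on the support of the flow; the second sends every other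
  state into the support at once, so that all stationary distributions of \<open>z\<close> live there.
\<close>

definition follows_flow :: "real^('n::finite \<times> 'n) \<Rightarrow> ('n \<Rightarrow> 'n pmf) \<Rightarrow> bool" where
  "follows_flow x z \<longleftrightarrow>
     (\<forall>k j. x $ (k, j) = outflow x k * pmf (z k) j) \<and> (\<forall>k. \<forall>j\<in>set_pmf (z k). outflow x j \<noteq> 0)"

lemma outflow_nonneg: "x \<in> flows \<Longrightarrow> 0 \<le> outflow x k"
  by (auto simp: flows_def outflow_def intro: sum_nonneg)

lemma exists_outflow_nonzero: "x \<in> flows \<Longrightarrow> \<exists>l. outflow x l \<noteq> 0"
  by (rule ccontr) (simp add: flows_def)

lemma exists_follows_flow:
  assumes x: "x \<in> flows"
  shows "\<exists>z. follows_flow x z"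
proof -
  obtain l where l: "outflow x l \<noteq> 0" using exists_outflow_nonzero[OF x] by blast
  have "\<exists>q. (\<forall>j. x $ (k, j) = outflow x k * pmf q j) \<and> (\<forall>j\<in>set_pmf q. outflow x j \<noteq> 0)" for k
  proof (cases "outflow x k = 0")
    case True
    then have "x $ (k, j) = 0" for j
      using x by (auto simp: flows_def outflow_def sum_nonneg_eq_0_iff)
    then show ?thesis using True l by (intro exI[of _ "return_pmf l"]) auto
  next
    case False
    define q where "q = embed_pmf (\<lambda>j. x $ (k, j) / outflow x k)"
    have "(\<Sum>j\<in>UNIV. x $ (k, j) / outflow x k) = 1"
      using False by (simp add: sum_divide_distrib[symmetric] outflow_def)
    then have q: "pmf q j = x $ (k, j) / outflow x k" for j
      unfolding q_def using x outflow_nonneg[OF x, of k]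
      by (intro pmf_embed_pmf) (auto simp: nn_integral_count_space_finite sum_ennreal flows_def)
    have "outflow x j \<noteq> 0" if "j \<in> set_pmf q" for j
    proof
      assume "outflow x j = 0"
      then have "(\<Sum>k\<in>UNIV. x $ (k, j)) = 0" using x by (simp add: flows_def)
      then have "\<forall>k\<in>UNIV. x $ (k, j) = 0"
        using x by (subst (asm) sum_nonneg_eq_0_iff) (auto simp: flows_def)
      then show False using that q by (simp add: set_pmf_iff)
    qed
    then show ?thesis using q False by (intro exI[of _ q]) auto
  qed
  then have "\<forall>k. \<exists>q. (\<forall>j. x $ (k, j) = outflow x k * pmf q j) \<and> (\<forall>j\<in>set_pmf q. outflow x j \<noteq> 0)" by blast
  from choice[OF this] show ?thesis unfolding follows_flow_def by blast
qed

text \<open>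
  The expected stage payoff in state \<open>k\<close> when Player 1 replies optimally to \<open>z k\<close>.
\<close>

definition state_cost :: "real^'n::finite^'m \<Rightarrow> real^'n^'n \<Rightarrow> real \<Rightarrow> ('n \<Rightarrow> 'n pmf) \<Rightarrow> 'n \<Rightarrow> real" where
  "state_cost A S c z k =
     (MAX i. \<Sum>j\<in>UNIV. pmf (z k) j * A $ i $ j) + c * (\<Sum>j\<in>UNIV. pmf (z k) j * S $ k $ j)"

lemma Max_range_mult_left:
  fixes f :: "'i::finite \<Rightarrow> real"
  assumes "0 \<le> b"
  shows "(MAX i. b * f i) = b * (MAX i. f i)"
  using mono_Max_commute[of "\<lambda>x. b * x" "range f"] assms
  by (simp add: mono_def mult_left_mono image_image)

lemma flow_cost_policy:
  assumes "\<And>k. 0 \<le> \<nu> k" and "\<And>k j. x $ (k, j) = \<nu> k * pmf (z k) j"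
  shows "flow_cost A S c x = (\<Sum>k\<in>UNIV. \<nu> k * state_cost A S c z k)"
  using assms
  by (simp add: flow_cost_def matrix_cost_def switching_rate_def state_cost_def mult.assoc
      sum_distrib_left[symmetric] Max_range_mult_left sum.distrib distrib_left mult.left_commute[of _ c])

lemma sum_pmf_UNIV: "(\<Sum>j\<in>UNIV. pmf p j) = 1" for p :: "'a::finite pmf"
  by (rule sum_pmf_eq_1) auto

text \<open>
  Write \<open>\<mu> z\<close> for the flow \<open>\<mu> k * pmf (z k) j\<close>.  A stationary distribution \<open>\<mu>\<close> is carried by the support
  of \<open>x\<close>, so \<open>(x - e * (\<mu> z)) / (1 - e)\<close> is a flow for small \<open>e\<close>, and its cost is at least that of \<open>x\<close>.
  Along the policy \<open>z\<close> the cost is linear in the weights of the states (\<open>flow_cost_policy\<close>), hence the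
  cost of \<open>\<mu> z\<close> is at most that of \<open>x\<close>.
\<close>

lemma stationary_cost_le:
  fixes A :: "real^'n::finite^'m"
  assumes x: "x \<in> flows" and min: "\<And>x'. x' \<in> flows \<Longrightarrow> flow_cost A S c x \<le> flow_cost A S c x'"
    and z: "follows_flow x z"
    and \<mu>: "\<And>k. 0 \<le> \<mu> k" "(\<Sum>k\<in>UNIV. \<mu> k) = 1" and stat: "\<And>j. (\<Sum>k\<in>UNIV. \<mu> k * pmf (z k) j) = \<mu> j"
  shows "(\<Sum>k\<in>UNIV. \<mu> k * state_cost A S c z k) \<le> flow_cost A S c x"
proof -
  let ?q = "outflow x" and ?r = "state_cost A S c z" and ?V = "flow_cost A S c x"
  have q: "0 \<le> ?q k" for k using outflow_nonneg[OF x] .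
  have supp: "\<mu> j = 0" if "?q j = 0" for j
  proof -
    have "j \<notin> set_pmf (z k)" for k using z that by (auto simp: follows_flow_def)
    then have "pmf (z k) j = 0" for k by (simp add: pmf_eq_0_set_pmf)
    then show ?thesis using stat[of j] by simp
  qed
  have xz: "x $ (k, j) = ?q k * pmf (z k) j" for k j using z by (simp add: follows_flow_def)
  define P where "P = {k. ?q k \<noteq> 0}"
  have "P \<noteq> {}" using exists_outflow_nonzero[OF x] by (auto simp: P_def)
  \<comment> \<open>the half keeps \<open>e\<close> below 1, and \<open>e * \<mu> k\<close> is at most the smallest positive outflow\<close>
  define e where "e = Min (?q ` P) / 2"
  have "Min (?q ` P) \<in> ?q ` P" using \<open>P \<noteq> {}\<close> by (intro Min_in) auto
  then obtain l where l: "l \<in> P" "Min (?q ` P) = ?q l" by auto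
  then have "0 < e" using q[of l] by (auto simp: e_def P_def less_le)
  have "?q l \<le> 1"
    using x member_le_sum[of l UNIV ?q] q by (simp add: flows_def)
  then have "e < 1" by (simp add: e_def l)
  have "\<mu> k \<le> 1" for k using member_le_sum[of k UNIV \<mu>] \<mu> by simp
  have \<nu>: "0 \<le> ?q k - e * \<mu> k" for k
  proof (cases "k \<in> P")
    case True
    then have "2 * e \<le> ?q k" by (simp add: e_def)
    moreover have "e * \<mu> k \<le> e * 1" using \<open>0 < e\<close> \<open>\<mu> k \<le> 1\<close> by (intro mult_left_mono) auto
    ultimately show ?thesis using \<open>0 < e\<close> by linarith
  qed (use supp in \<open>simp add: P_def\<close>)
  define \<nu> where "\<nu> k = (?q k - e * \<mu> k) / (1 - e)" for k
  define x' where "x' = (\<chi> p. \<nu> (fst p) * pmf (z (fst p)) (snd p))"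
  have out: "outflow x' k = \<nu> k" for k
    by (simp add: outflow_def x'_def sum_distrib_left[symmetric] sum_pmf_UNIV)
  have "(\<Sum>k\<in>UNIV. x' $ (k, j)) = \<nu> j" for j
  proof -
    have "(\<Sum>k\<in>UNIV. ?q k * pmf (z k) j) = ?q j" using x by (simp add: flows_def flip: xz)
    then have "(\<Sum>k\<in>UNIV. (?q k - e * \<mu> k) * pmf (z k) j) = ?q j - e * \<mu> j"
      using stat[of j] by (simp add: left_diff_distrib sum_subtractf mult.assoc sum_distrib_left[symmetric])
    then show ?thesis by (simp add: x'_def \<nu>_def sum_divide_distrib[symmetric])
  qed
  moreover have "(\<Sum>k\<in>UNIV. \<nu> k) = 1"
    using x \<mu> \<open>e < 1\<close>
    by (simp add: \<nu>_def sum_divide_distrib[symmetric] sum_subtractf sum_distrib_left[symmetric] flows_def)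
  moreover have \<nu>0: "0 \<le> \<nu> k" for k using \<nu> \<open>e < 1\<close> by (simp add: \<nu>_def)
  ultimately have "x' \<in> flows" by (simp add: flows_def out) (simp add: x'_def)
  then have "?V \<le> flow_cost A S c x'" by (rule min)
  also have "\<dots> = (\<Sum>k\<in>UNIV. \<nu> k * ?r k)"
    using \<nu>0 by (intro flow_cost_policy) (auto simp: x'_def)
  also have "\<dots> = ((\<Sum>k\<in>UNIV. ?q k * ?r k) - e * (\<Sum>k\<in>UNIV. \<mu> k * ?r k)) / (1 - e)"
    by (simp add: \<nu>_def sum_divide_distrib[symmetric] left_diff_distrib sum_subtractf sum_distrib_left mult.assoc)
  also have "(\<Sum>k\<in>UNIV. ?q k * ?r k) = ?V"
    using q xz by (intro flow_cost_policy[symmetric]) auto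
  finally have "e * (\<Sum>k\<in>UNIV. \<mu> k * ?r k) \<le> e * ?V"
    using \<open>e < 1\<close> by (simp add: field_simps)
  then show ?thesis using \<open>0 < e\<close> by simp
qed

text \<open>
  An approximate solution \<open>h\<close> of the Poisson equation for the chain \<open>z\<close>.  A weight that is not stationary is
  beaten by choosing \<open>h\<close>, and for a stationary one \<open>stationary_cost_le\<close> applies.
\<close>

lemma policy_potential:
  fixes A :: "real^'n::finite^'m"
  assumes x: "x \<in> flows" and min: "\<And>x'. x' \<in> flows \<Longrightarrow> flow_cost A S c x \<le> flow_cost A S c x'"
    and z: "follows_flow x z" and v: "flow_cost A S c x < v"
  shows "\<exists>h. \<forall>k. state_cost A S c z k + (\<Sum>j\<in>UNIV. pmf (z k) j * h j) - h k \<le> v"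
proof -
  let ?r = "state_cost A S c z"
  define g where "g h = (\<chi> k. h k - ?r k - (\<Sum>j\<in>UNIV. pmf (z k) j * h j))" for h :: "'n \<Rightarrow> real"
  have "convex (range g)"
  proof (rule convexI)
    fix a b and s t :: real
    assume st: "s + t = 1" and "a \<in> range g" "b \<in> range g"
    then obtain h h' where ab: "a = g h" "b = g h'" by auto
    have t: "t = 1 - s" using st by simp
    have "s *\<^sub>R a + t *\<^sub>R b = g (\<lambda>k. s * h k + t * h' k)"
      unfolding ab g_def vec_eq_iff t
      by (simp add: sum.distrib sum_subtractf sum_distrib_left algebra_simps)
    then show "s *\<^sub>R a + t *\<^sub>R b \<in> range g" by simp
  qed
  moreover have "\<exists>a\<in>range g. - v < \<mu> \<bullet> a"
    if \<mu>: "\<forall>k. 0 \<le> \<mu> $ k" "(\<Sum>k\<in>UNIV. \<mu> $ k) = 1" for \<mu> :: "real^'n"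
  proof -
    have inner: "\<mu> \<bullet> g h = - (\<Sum>k\<in>UNIV. \<mu> $ k * ?r k)
        + (\<Sum>j\<in>UNIV. h j * (\<mu> $ j - (\<Sum>k\<in>UNIV. \<mu> $ k * pmf (z k) j)))" for h
    proof -
      have "(\<Sum>k\<in>UNIV. \<mu> $ k * (\<Sum>j\<in>UNIV. pmf (z k) j * h j)) = (\<Sum>j\<in>UNIV. h j * (\<Sum>k\<in>UNIV. \<mu> $ k * pmf (z k) j))"
        unfolding sum_distrib_left by (subst sum.swap) (simp add: mult_ac)
      then show ?thesis
        by (simp add: inner_vec_def g_def right_diff_distrib sum_subtractf mult.commute)
    qed
    have "\<exists>h. - v < - (\<Sum>k\<in>UNIV. \<mu> $ k * ?r k)
        + (\<Sum>j\<in>UNIV. h j * (\<mu> $ j - (\<Sum>k\<in>UNIV. \<mu> $ k * pmf (z k) j)))"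
    proof (rule exists_multiplier)
      assume "\<forall>j. \<mu> $ j - (\<Sum>k\<in>UNIV. \<mu> $ k * pmf (z k) j) = 0"
      then have stat: "(\<Sum>k\<in>UNIV. \<mu> $ k * pmf (z k) j) = \<mu> $ j" for j
        by (metis right_minus_eq)
      have "(\<Sum>k\<in>UNIV. \<mu> $ k * ?r k) \<le> flow_cost A S c x"
        by (rule stationary_cost_le[OF x min z]) (use \<mu> stat in blast)+
      then show "- v < - (\<Sum>k\<in>UNIV. \<mu> $ k * ?r k)" using v by simp
    qed
    then obtain h where "- v < - (\<Sum>k\<in>UNIV. \<mu> $ k * ?r k)
        + (\<Sum>j\<in>UNIV. h j * (\<mu> $ j - (\<Sum>k\<in>UNIV. \<mu> $ k * pmf (z k) j)))" by blast
    then show ?thesis using inner[of h] by (intro bexI[of _ "g h"]) simp_all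
  qed
  ultimately obtain h where "\<forall>k. - v \<le> g h $ k"
    using convex_dominates_if_no_separating_weight[of "range g" "- v"] by auto
  then show ?thesis by (intro exI[of _ h]) (auto simp: g_def algebra_simps)
qed

section \<open>The law of finite histories\<close>

abbreviation stage_pmf :: "('m, 'n) strategy1 \<Rightarrow> ('m, 'n) strategy2 \<Rightarrow> ('m, 'n) history \<Rightarrow> ('m \<times> 'n) pmf" where
  "stage_pmf \<sigma> \<tau> h \<equiv> pair_pmf (\<sigma> h) (\<tau> h)"

text \<open>
  The marginal laws of the play as finitely supported mass functions: conditioning on the history then becomes
  a finite sum, and the martingale argument needs no conditional expectations.
\<close>

primrec history_pmf :: "('m, 'n) strategy1 \<Rightarrow> ('m, 'n) strategy2 \<Rightarrow> nat \<Rightarrow> ('m, 'n) history pmf" where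
  "history_pmf \<sigma> \<tau> 0 = return_pmf []"
| "history_pmf \<sigma> \<tau> (Suc t) =
     bind_pmf (history_pmf \<sigma> \<tau> t) (\<lambda>h. map_pmf (\<lambda>a. h @ [a]) (stage_pmf \<sigma> \<tau> h))"

lemma set_history_pmf: "set_pmf (history_pmf \<sigma> \<tau> t) \<subseteq> {h. length h = t}"
  by (induction t) auto

lemma finite_set_history_pmf: "finite (set_pmf (history_pmf \<sigma> \<tau> t))"
  for \<sigma> :: "('m::finite, 'n::finite) strategy1"
  by (rule finite_subset[OF set_history_pmf]) (use finite_lists_length_eq[OF finite[of "UNIV :: ('m \<times> 'n) set"], of t] in simp)

lemma pmf_history_snoc:
  fixes \<sigma> :: "('m::finite, 'n::finite) strategy1"
  shows "pmf (history_pmf \<sigma> \<tau> (Suc t)) (h @ [a]) = pmf (history_pmf \<sigma> \<tau> t) h * pmf (stage_pmf \<sigma> \<tau> h) a"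
proof -
  have "pmf (map_pmf (\<lambda>a. h' @ [a]) (stage_pmf \<sigma> \<tau> h')) (h @ [a]) = (if h' = h then pmf (stage_pmf \<sigma> \<tau> h) a else 0)"
    for h'
  proof (cases "h' = h")
    case True
    then show ?thesis using pmf_map_inj'[of "\<lambda>a. h @ [a]" "stage_pmf \<sigma> \<tau> h" a] by (simp add: inj_def)
  next
    case False
    then show ?thesis by (auto simp: pmf_eq_0_set_pmf)
  qed
  then have "pmf (history_pmf \<sigma> \<tau> (Suc t)) (h @ [a]) =
      measure_pmf.expectation (history_pmf \<sigma> \<tau> t) (\<lambda>h'. if h' = h then pmf (stage_pmf \<sigma> \<tau> h) a else 0)"
    by (simp add: pmf_bind)
  also have "\<dots> = (\<Sum>h'\<in>{h}. pmf (history_pmf \<sigma> \<tau> t) h' *\<^sub>R (if h' = h then pmf (stage_pmf \<sigma> \<tau> h) a else 0))"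
    by (rule integral_measure_pmf) (auto split: if_splits)
  finally show ?thesis by simp
qed

lemma pmf_history:
  fixes \<sigma> :: "('m::finite, 'n::finite) strategy1"
  shows "pmf (history_pmf \<sigma> \<tau> (length h)) h =
    (\<Prod>t<length h. pmf (\<sigma> (take t h)) (fst (h ! t)) * pmf (\<tau> (take t h)) (snd (h ! t)))"
proof (induction h rule: rev_induct)
  case (snoc a h)
  show ?case
    using snoc by (cases a) (simp add: pmf_history_snoc pmf_pair nth_append del: history_pmf.simps(2))
qed simp

lemma measurable_history [measurable]:
  "(\<lambda>\<omega>. map \<omega> [0..<t]) \<in> PiM UNIV (\<lambda>_. count_space UNIV) \<rightarrow>\<^sub>M count_space (UNIV :: 'a::countable list set)"
proof (induction t)
  case (Suc t)
  have "(\<lambda>\<omega>. (map \<omega> [0..<t], \<omega> t)) \<in> PiM UNIV (\<lambda>_. count_space (UNIV :: 'a set)) \<rightarrow>\<^sub>M count_space UNIV \<Otimes>\<^sub>M count_space UNIV"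
    using Suc by measurable
  then have "(\<lambda>\<omega>. (map \<omega> [0..<t], \<omega> t)) \<in> PiM UNIV (\<lambda>_. count_space (UNIV :: 'a set)) \<rightarrow>\<^sub>M count_space UNIV"
    by (simp add: pair_measure_countable)
  from measurable_compose[OF this, of "\<lambda>(h, a). h @ [a]" "count_space UNIV"] show ?case by simp
qed simp

lemma distr_history:
  fixes \<sigma> :: "('m::finite, 'n::finite) strategy1"
  shows "distr (play_measure \<sigma> \<tau>) (count_space UNIV) (\<lambda>\<omega>. map \<omega> [0..<t]) = measure_pmf (history_pmf \<sigma> \<tau> t)"
proof (rule measure_eqI_countable[of _ UNIV])
  fix h :: "('m, 'n) history"
  have "emeasure (distr (play_measure \<sigma> \<tau>) (count_space UNIV) (\<lambda>\<omega>. map \<omega> [0..<t])) {h} =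
      emeasure (play_measure \<sigma> \<tau>) {\<omega>. map \<omega> [0..<t] = h}"
    by (subst emeasure_distr)
       (auto simp: space_play_measure measurable_cong_sets[OF sets_play_measure refl] vimage_def measurable_history)
  also have "\<dots> = emeasure (measure_pmf (history_pmf \<sigma> \<tau> t)) {h}"
  proof (cases "length h = t")
    case True
    then show ?thesis
      using emeasure_play_measure_cylinder[of \<sigma> \<tau> h] pmf_history[of \<sigma> \<tau> h] by (simp add: emeasure_pmf_single)
  next
    case False
    then have "{\<omega>. map \<omega> [0..<t] = h} = {}" by auto
    moreover have "pmf (history_pmf \<sigma> \<tau> t) h = 0"
      using False set_history_pmf[of \<sigma> \<tau> t] by (auto simp: pmf_eq_0_set_pmf)
    ultimately show ?thesis by (simp add: emeasure_pmf_single del: emeasure_empty) simp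
  qed
  finally show "emeasure (distr (play_measure \<sigma> \<tau>) (count_space UNIV) (\<lambda>\<omega>. map \<omega> [0..<t])) {h} =
    emeasure (measure_pmf (history_pmf \<sigma> \<tau> t)) {h}" .
qed auto

lemma expectation_history_Suc:
  fixes \<sigma> :: "('m::finite, 'n::finite) strategy1" and f :: "('m, 'n) history \<Rightarrow> real"
  shows "measure_pmf.expectation (history_pmf \<sigma> \<tau> (Suc t)) f =
    measure_pmf.expectation (history_pmf \<sigma> \<tau> t)
      (\<lambda>h. measure_pmf.expectation (stage_pmf \<sigma> \<tau> h) (\<lambda>a. f (h @ [a])))"
  unfolding history_pmf.simps
  by (subst pmf_expectation_bind[OF finite_set_history_pmf _ order_refl])
     (auto simp: integral_measure_pmf[OF finite_set_history_pmf])

section \<open>A strong law for bounded martingale differences\<close>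

definition history_sum :: "(('m, 'n) history \<Rightarrow> 'm \<times> 'n \<Rightarrow> real) \<Rightarrow> ('m, 'n) history \<Rightarrow> real" where
  "history_sum d h = (\<Sum>t<length h. d (take t h) (h ! t))"

lemma history_sum_snoc [simp]: "history_sum d (h @ [a]) = history_sum d h + d h a"
  by (simp add: history_sum_def nth_append)

lemma history_sum_map: "history_sum d (map \<omega> [0..<T]) = (\<Sum>t<T. d (map \<omega> [0..<t]) (\<omega> t))"
  by (simp add: history_sum_def take_map)

text \<open>
  Increments with conditional mean zero are orthogonal.
\<close>

lemma second_moment_martingale:
  fixes \<sigma> :: "('m::finite, 'n::finite) strategy1"
  assumes bound: "\<And>h a. \<bar>d h a\<bar> \<le> B"
    and centred: "\<And>h. measure_pmf.expectation (stage_pmf \<sigma> \<tau> h) (d h) = 0"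
  shows "measure_pmf.expectation (history_pmf \<sigma> \<tau> t) (\<lambda>h. (history_sum d h)\<^sup>2) \<le> real t * B\<^sup>2"
proof (induction t)
  case (Suc t)
  have int: "integrable (measure_pmf (stage_pmf \<sigma> \<tau> h)) f" for h and f :: "_ \<Rightarrow> real"
    by (rule integrable_measure_pmf_finite) simp
  have inth: "integrable (measure_pmf (history_pmf \<sigma> \<tau> t)) f" for f :: "_ \<Rightarrow> real"
    by (rule integrable_measure_pmf_finite) (rule finite_set_history_pmf)
  have sq: "(d h a)\<^sup>2 \<le> B\<^sup>2" for h a using bound[of h a] by (simp add: abs_le_square_iff[symmetric])
  have "measure_pmf.expectation (stage_pmf \<sigma> \<tau> h) (\<lambda>a. (history_sum d (h @ [a]))\<^sup>2) \<le> (history_sum d h)\<^sup>2 + B\<^sup>2" for h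
  proof -
    have "measure_pmf.expectation (stage_pmf \<sigma> \<tau> h) (\<lambda>a. (history_sum d (h @ [a]))\<^sup>2) =
       (history_sum d h)\<^sup>2 + measure_pmf.expectation (stage_pmf \<sigma> \<tau> h) (\<lambda>a. (d h a)\<^sup>2)"
      using centred[of h] by (simp add: power2_sum int)
    also have "measure_pmf.expectation (stage_pmf \<sigma> \<tau> h) (\<lambda>a. (d h a)\<^sup>2) \<le> B\<^sup>2"
      by (intro measure_pmf.integral_le_const int AE_I2 sq)
    finally show ?thesis by simp
  qed
  then have "measure_pmf.expectation (history_pmf \<sigma> \<tau> (Suc t)) (\<lambda>h. (history_sum d h)\<^sup>2) \<le>
      measure_pmf.expectation (history_pmf \<sigma> \<tau> t) (\<lambda>h. (history_sum d h)\<^sup>2 + B\<^sup>2)"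
    unfolding expectation_history_Suc by (intro integral_mono inth)
  also have "\<dots> = measure_pmf.expectation (history_pmf \<sigma> \<tau> t) (\<lambda>h. (history_sum d h)\<^sup>2) + B\<^sup>2"
    by (simp add: inth)
  finally show ?case using Suc.IH by (simp add: algebra_simps)
qed (simp add: history_sum_def)

text \<open>
  By monotone convergence the sum of the squares has finite mean, so it is finite almost surely.
\<close>

lemma AE_tendsto_0_if_summable_second_moment:
  fixes X :: "nat \<Rightarrow> 'a \<Rightarrow> real"
  assumes [measurable]: "\<And>n. X n \<in> borel_measurable M"
    and bound: "\<And>n. (\<integral>\<^sup>+ \<omega>. ennreal ((X n \<omega>)\<^sup>2) \<partial>M) \<le> ennreal (b n)" and "summable b" "\<And>n. 0 \<le> b n"
  shows "AE \<omega> in M. (\<lambda>n. X n \<omega>) \<longlonglongrightarrow> 0"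
proof -
  have "(\<integral>\<^sup>+ \<omega>. (\<Sum>n. ennreal ((X n \<omega>)\<^sup>2)) \<partial>M) = (\<Sum>n. \<integral>\<^sup>+ \<omega>. ennreal ((X n \<omega>)\<^sup>2) \<partial>M)"
    by (rule nn_integral_suminf) measurable
  also have "\<dots> \<le> (\<Sum>n. ennreal (b n))" by (intro suminf_le bound) auto
  also have "\<dots> = ennreal (\<Sum>n. b n)" using assms by (intro suminf_ennreal2) auto
  finally have "(\<integral>\<^sup>+ \<omega>. (\<Sum>n. ennreal ((X n \<omega>)\<^sup>2)) \<partial>M) \<noteq> \<infinity>" by (auto simp: top_unique)
  then have "AE \<omega> in M. (\<Sum>n. ennreal ((X n \<omega>)\<^sup>2)) \<noteq> \<infinity>"
    by (intro nn_integral_PInf_AE) measurable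
  then show ?thesis
  proof eventually_elim
    case (elim \<omega>)
    then have "summable (\<lambda>n. (X n \<omega>)\<^sup>2)" by (intro summable_suminf_not_top) auto
    then have "(\<lambda>n. (X n \<omega>)\<^sup>2) \<longlonglongrightarrow> 0" by (rule summable_LIMSEQ_zero)
    then show ?case by simp
  qed
qed

text \<open>
  From \<open>n\<^sup>2\<close> to any \<open>T < (n + 1)\<^sup>2\<close> the sequence \<open>s\<close> moves by at most \<open>2 * n * B\<close>, which is negligible against
  \<open>n\<^sup>2\<close>.
\<close>

lemma average_tendsto_0_of_squares:
  fixes s :: "nat \<Rightarrow> real"
  assumes step: "\<And>n. \<bar>s (Suc n) - s n\<bar> \<le> B"
    and lim: "(\<lambda>n. s ((Suc n)\<^sup>2) / real ((Suc n)\<^sup>2)) \<longlonglongrightarrow> 0"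
  shows "(\<lambda>T. s T / real T) \<longlonglongrightarrow> 0"
proof -
  have "0 \<le> B" using step[of 0] by simp
  have lip: "\<bar>s (m + k) - s m\<bar> \<le> real k * B" for m k
  proof (induction k)
    case (Suc k)
    then show ?case using step[of "m + k"] by (simp add: algebra_simps)
  qed simp
  \<comment> \<open>shifted by one, because the given limit is indexed by \<open>Suc n\<close>\<close>
  define r where "r T = floor_sqrt T - 1" for T
  have r_top: "filterlim r at_top at_top"
    unfolding filterlim_at_top
  proof
    fix N
    have "N \<le> r T" if "(Suc N)\<^sup>2 \<le> T" for T
    proof -
      have "Suc N \<le> floor_sqrt T" using that by (simp only: le_floor_sqrt_iff)
      then show ?thesis by (simp add: r_def)
    qed
    then show "\<forall>\<^sub>F T in sequentially. N \<le> r T" by (auto simp: eventually_at_top_linorder)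
  qed
  define q where "q n = \<bar>s ((Suc n)\<^sup>2) / real ((Suc n)\<^sup>2)\<bar> + 2 * B / real (Suc n)" for n
  have "q \<longlonglongrightarrow> 0"
    unfolding q_def
    using tendsto_add[OF tendsto_rabs_zero[OF lim] LIMSEQ_Suc[OF lim_const_over_n[of "2 * B"]]] by simp
  then have "(\<lambda>T. q (r T)) \<longlonglongrightarrow> 0" using r_top by (rule filterlim_compose)
  moreover have "\<forall>\<^sub>F T in sequentially. norm (s T / real T) \<le> q (r T)"
  proof (rule eventually_mono[OF eventually_ge_at_top[of 1]])
    fix T :: nat assume "1 \<le> T"
    define n where "n = floor_sqrt T"
    have "1 \<le> n" using \<open>1 \<le> T\<close> by (simp add: n_def le_floor_sqrt_iff)
    have "n\<^sup>2 \<le> T" "T < (Suc n)\<^sup>2" by (simp_all add: n_def Suc_floor_sqrt_power2_gt)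
    then have "\<bar>s T - s (n\<^sup>2)\<bar> \<le> real (T - n\<^sup>2) * B" using lip[of "n\<^sup>2" "T - n\<^sup>2"] by simp
    also have "\<dots> \<le> real (2 * n) * B"
      using \<open>T < (Suc n)\<^sup>2\<close> \<open>0 \<le> B\<close> by (intro mult_right_mono) (auto simp: power2_eq_square)
    finally have "\<bar>s T\<bar> \<le> \<bar>s (n\<^sup>2)\<bar> + real (2 * n) * B" by simp
    then have "\<bar>s T\<bar> / real T \<le> (\<bar>s (n\<^sup>2)\<bar> + real (2 * n) * B) / real (n\<^sup>2)"
      using \<open>n\<^sup>2 \<le> T\<close> \<open>1 \<le> n\<close> \<open>0 \<le> B\<close> by (intro frac_le) (auto simp flip: of_nat_power)
    also have "\<dots> = q (r T)"
      using \<open>1 \<le> n\<close> by (simp add: q_def r_def n_def[symmetric] add_divide_distrib power2_eq_square)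
    finally show "norm (s T / real T) \<le> q (r T)" by simp
  qed
  ultimately show ?thesis by (rule Lim_null_comparison[rotated])
qed

text \<open>
  By orthogonality the second moment of the average at time \<open>n\<^sup>2\<close> is at most \<open>B\<^sup>2 / n\<^sup>2\<close>, which is summable; so
  the averages converge along the squares, and bounded increments fill the gaps.
\<close>

lemma AE_average_martingale_tendsto_0:
  fixes \<sigma> :: "('m::finite, 'n::finite) strategy1"
  assumes bound: "\<And>h a. \<bar>d h a\<bar> \<le> B"
    and centred: "\<And>h. measure_pmf.expectation (stage_pmf \<sigma> \<tau> h) (d h) = 0"
  shows "AE \<omega> in play_measure \<sigma> \<tau>. (\<lambda>T. history_sum d (map \<omega> [0..<T]) / real T) \<longlonglongrightarrow> 0"
proof -
  let ?M = "play_measure \<sigma> \<tau>"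
  have meas: "(\<lambda>\<omega>. f (map \<omega> [0..<t])) \<in> borel_measurable ?M" for f :: "_ \<Rightarrow> real" and t
    unfolding measurable_cong_sets[OF sets_play_measure refl]
    by (rule measurable_compose[OF measurable_history]) simp
  have hist: "(\<lambda>\<omega>. map \<omega> [0..<t]) \<in> ?M \<rightarrow>\<^sub>M count_space UNIV" for t
    unfolding measurable_cong_sets[OF sets_play_measure refl] by (rule measurable_history)
  have "AE \<omega> in ?M. (\<lambda>n. history_sum d (map \<omega> [0..<(Suc n)\<^sup>2]) / real ((Suc n)\<^sup>2)) \<longlonglongrightarrow> 0"
  proof (rule AE_tendsto_0_if_summable_second_moment)
    fix n
    let ?t = "(Suc n)\<^sup>2" and ?p = "history_pmf \<sigma> \<tau> ((Suc n)\<^sup>2)"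
    show "(\<lambda>\<omega>. history_sum d (map \<omega> [0..<?t]) / real ?t) \<in> borel_measurable ?M" by (rule meas)
    have "(\<integral>\<^sup>+ \<omega>. ennreal ((history_sum d (map \<omega> [0..<?t]) / real ?t)\<^sup>2) \<partial>?M) =
        (\<integral>\<^sup>+ h. ennreal ((history_sum d h / real ?t)\<^sup>2) \<partial>measure_pmf ?p)"
      unfolding distr_history[symmetric] by (subst nn_integral_distr[OF hist]) auto
    also have "\<dots> = ennreal (measure_pmf.expectation ?p (\<lambda>h. (history_sum d h / real ?t)\<^sup>2))"
      by (rule nn_integral_eq_integral) (auto intro: integrable_measure_pmf_finite finite_set_history_pmf)
    also have "measure_pmf.expectation ?p (\<lambda>h. (history_sum d h / real ?t)\<^sup>2) =
        measure_pmf.expectation ?p (\<lambda>h. (history_sum d h)\<^sup>2) / (real ?t)\<^sup>2"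
      by (simp add: power_divide)
    also have "\<dots> \<le> real ?t * B\<^sup>2 / (real ?t)\<^sup>2"
      by (intro divide_right_mono second_moment_martingale bound centred) auto
    also have "\<dots> = B\<^sup>2 * (1 / (real (Suc n))\<^sup>2)"
      unfolding of_nat_power by (simp add: power2_eq_square del: of_nat_Suc)
    finally show "(\<integral>\<^sup>+ \<omega>. ennreal ((history_sum d (map \<omega> [0..<?t]) / real ?t)\<^sup>2) \<partial>?M)
        \<le> ennreal (B\<^sup>2 * (1 / (real (Suc n))\<^sup>2))" by (simp add: ennreal_leI)
  next
    have "summable (\<lambda>n. 1 / (real (Suc n))\<^sup>2)"
      using inverse_power_summable[of 2, where 'a = real]
      by (subst summable_Suc_iff) (simp add: divide_inverse)
    then show "summable (\<lambda>n. B\<^sup>2 * (1 / (real (Suc n))\<^sup>2))" by (rule summable_mult)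
  qed simp
  then show ?thesis
  proof eventually_elim
    case (elim \<omega>)
    have "\<bar>history_sum d (map \<omega> [0..<Suc n]) - history_sum d (map \<omega> [0..<n])\<bar> \<le> B" for n
      using bound by simp
    from average_tendsto_0_of_squares[of "\<lambda>T. history_sum d (map \<omega> [0..<T])", OF this elim] show ?case .
  qed
qed

text \<open>
  The function \<open>f\<close> exceeds its conditional mean by a martingale difference, whose averages vanish.
\<close>

lemma AE_average_ge:
  fixes \<sigma> :: "('m::finite, 'n::finite) strategy1"
  assumes bound: "\<And>h a. \<bar>f h a\<bar> \<le> B"
    and drift: "\<And>h. v \<le> measure_pmf.expectation (stage_pmf \<sigma> \<tau> h) (f h)"
  shows "AE \<omega> in play_measure \<sigma> \<tau>. \<forall>e>0. \<forall>\<^sub>F T in sequentially. v - e \<le> history_sum f (map \<omega> [0..<T]) / real T"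
proof -
  define m where "m h = measure_pmf.expectation (stage_pmf \<sigma> \<tau> h) (f h)" for h
  define d where "d h a = f h a - m h" for h a
  have int: "integrable (measure_pmf (stage_pmf \<sigma> \<tau> h)) g" for h and g :: "_ \<Rightarrow> real"
    by (rule integrable_measure_pmf_finite) simp
  have "- B \<le> f h a" "f h a \<le> B" for h a using bound[of h a] by auto
  then have "- B \<le> m h" "m h \<le> B" for h
    unfolding m_def by (auto intro!: measure_pmf.integral_ge_const measure_pmf.integral_le_const int)
  then have "\<bar>d h a\<bar> \<le> 2 * B" for h a
    using bound[of h a] \<open>\<And>h. - B \<le> m h\<close>[of h] \<open>\<And>h. m h \<le> B\<close>[of h] unfolding d_def by linarith
  moreover have "measure_pmf.expectation (stage_pmf \<sigma> \<tau> h) (d h) = 0" for h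
    by (simp add: d_def[abs_def] int m_def)
  ultimately have "AE \<omega> in play_measure \<sigma> \<tau>. (\<lambda>T. history_sum d (map \<omega> [0..<T]) / real T) \<longlonglongrightarrow> 0"
    by (rule AE_average_martingale_tendsto_0)
  then show ?thesis
  proof (eventually_elim, intro allI impI)
    fix \<omega> and e :: real
    assume lim: "(\<lambda>T. history_sum d (map \<omega> [0..<T]) / real T) \<longlonglongrightarrow> 0" and "0 < e"
    have "\<forall>\<^sub>F T in sequentially. - e < history_sum d (map \<omega> [0..<T]) / real T"
      by (rule order_tendstoD(1)[OF lim]) (use \<open>0 < e\<close> in simp)
    then show "\<forall>\<^sub>F T in sequentially. v - e \<le> history_sum f (map \<omega> [0..<T]) / real T"
      using eventually_gt_at_top[of 0]
    proof eventually_elim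
      case (elim T)
      have "real T * v \<le> (\<Sum>t<T. m (map \<omega> [0..<t]))"
        using sum_mono[of "{..<T}" "\<lambda>_. v"] drift by (simp add: m_def)
      moreover have "history_sum f (map \<omega> [0..<T]) = history_sum d (map \<omega> [0..<T]) + (\<Sum>t<T. m (map \<omega> [0..<t]))"
        by (simp add: history_sum_map d_def sum_subtractf)
      ultimately show ?case using elim by (simp add: field_simps)
    qed
  qed
qed

section \<open>Bounds on the payoff from a potential\<close>

text \<open>
  The stage payoff as if \<open>j0\<close> had been played before the first stage, plus the increment of \<open>w\<close>.  Its sums
  differ from those of the stage payoffs by a bounded amount, so both have the same long-run averages.
\<close>

definition potential_payoff ::
  "real^'n^'m \<Rightarrow> real^'n^'n \<Rightarrow> real \<Rightarrow> 'n \<Rightarrow> ('n \<Rightarrow> real) \<Rightarrow> ('m, 'n) history \<Rightarrow> 'm \<times> 'n \<Rightarrow> real" where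
  "potential_payoff A S c j0 w h = (\<lambda>(i, j).
     A $ i $ j + c * S $ previous_column j0 h $ j + w j - w (previous_column j0 h))"

lemma history_sum_potential_payoff:
  "history_sum (potential_payoff A S c j0 w) (map \<omega> [0..<T]) = (\<Sum>t<T. stage_payoff A S c \<omega> t)
     + (if T = 0 then 0 else c * S $ j0 $ snd (\<omega> 0)) + w (previous_column j0 (map \<omega> [0..<T])) - w j0"
proof (induction T)
  case (Suc T)
  have "previous_column j0 (map \<omega> [0..<T]) = (if T = 0 then j0 else snd (\<omega> (T - 1)))"
    by (cases T) (simp_all add: previous_column_def)
  then show ?case
    using Suc by (simp add: potential_payoff_def stage_payoff_def split_beta previous_column_def)
qed (simp add: history_sum_def previous_column_def)

lemma potential_payoff_bounds:
  fixes A :: "real^'n::finite^'m::finite"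
  obtains B D where "\<And>h a. \<bar>potential_payoff A S c j0 w h a\<bar> \<le> B"
    and "\<And>\<omega> T. \<bar>history_sum (potential_payoff A S c j0 w) (map \<omega> [0..<T]) - (\<Sum>t<T. stage_payoff A S c \<omega> t)\<bar> \<le> D"
proof -
  let ?f = "\<lambda>(k, i, j). \<bar>A $ i $ j\<bar> + \<bar>c * S $ k $ j\<bar> + \<bar>w j\<bar> + \<bar>w k\<bar>"
  define B where "B = Max (range ?f)"
  have B: "\<bar>A $ i $ j\<bar> + \<bar>c * S $ k $ j\<bar> + \<bar>w j\<bar> + \<bar>w k\<bar> \<le> B" for i j k
  proof -
    have "?f (k, i, j) \<le> Max (range ?f)" by (rule Max_ge) (simp, rule rangeI)
    then show ?thesis by (simp only: B_def prod.case)
  qed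
  have "\<bar>potential_payoff A S c j0 w h a\<bar> \<le> B" for h a
    using B[of "fst a" "snd a" "previous_column j0 h"] by (auto simp: potential_payoff_def split_beta)
  moreover have "\<bar>history_sum (potential_payoff A S c j0 w) (map \<omega> [0..<T]) - (\<Sum>t<T. stage_payoff A S c \<omega> t)\<bar> \<le> 3 * B"
    for \<omega> T
    using B[of "fst (\<omega> 0)" "snd (\<omega> 0)" j0] B[of undefined undefined "previous_column j0 (map \<omega> [0..<T])"]
    by (auto simp: history_sum_potential_payoff)
  ultimately show thesis by (rule that)
qed

lemma history_average_bounded:
  assumes "\<And>h a. \<bar>f h a\<bar> \<le> B"
  shows "\<bar>history_sum f (map \<omega> [0..<T]) / real T\<bar> \<le> B"
proof (cases "T = 0")
  case False
  have "\<bar>history_sum f (map \<omega> [0..<T])\<bar> \<le> (\<Sum>t<T. B)"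
    unfolding history_sum_map by (rule order_trans[OF sum_abs]) (intro sum_mono assms)
  then show ?thesis using False by (simp add: field_simps)
qed (use assms[of undefined undefined] in simp)

text \<open>
  The averages are bounded, so the lower limit is a real number and no default value of
  \<^const>\<open>real_of_ereal\<close> intervenes.
\<close>

lemma liminf_average_real_liminf:
  fixes A :: "real^'n::finite^'m::finite"
  obtains l where "liminf (\<lambda>T. ereal ((\<Sum>t<T. stage_payoff A S c \<omega> t) / real T)) = ereal l"
    and "liminf_average A S c \<omega> = l"
proof -
  let ?u = "\<lambda>T. (\<Sum>t<T. stage_payoff A S c \<omega> t) / real T"
  let ?f = "potential_payoff A S c undefined (\<lambda>_. 0)"
  obtain B D where B: "\<And>h a. \<bar>?f h a\<bar> \<le> B"
    and D: "\<And>\<omega> T. \<bar>history_sum ?f (map \<omega> [0..<T]) - (\<Sum>t<T. stage_payoff A S c \<omega> t)\<bar> \<le> D"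
    by (rule potential_payoff_bounds[of A S c undefined "\<lambda>_. 0"]) blast
  have "0 \<le> D" using D[of undefined 0] by linarith
  have u: "\<bar>?u T\<bar> \<le> B + D" for T
  proof (cases "T = 0")
    case False
    have "\<bar>history_sum ?f (map \<omega> [0..<T]) / real T - ?u T\<bar> \<le> D / real T"
      using D[of \<omega> T] by (simp add: diff_divide_distrib[symmetric] divide_right_mono)
    also have "\<dots> \<le> D" using False \<open>0 \<le> D\<close> by (simp add: field_simps mult_le_cancel_left1)
    finally show ?thesis using history_average_bounded[where f = ?f, OF B, of \<omega> T] by linarith
  qed (use B[of undefined undefined] \<open>0 \<le> D\<close> in simp)
  let ?L = "liminf (\<lambda>T. ereal (?u T))"
  have "ereal (- (B + D)) \<le> ?L"
    using u[THEN abs_le_D2] by (intro Liminf_bounded always_eventually) (simp add: minus_le_iff)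
  moreover have "?L \<le> ereal (B + D)"
    using u[THEN abs_le_D1]
    by (intro order_trans[OF Liminf_le_Limsup Limsup_bounded] always_eventually) simp_all
  ultimately have "?L = ereal (real_of_ereal ?L)" by (cases ?L) auto
  then show thesis by (rule that) (simp add: liminf_average_def)
qed

lemma history_average_close:
  assumes D: "\<And>T. \<bar>history_sum f (map \<omega> [0..<T]) - s T\<bar> \<le> D" and "0 < (e::real)"
  shows "\<forall>\<^sub>F T in sequentially. \<bar>history_sum f (map \<omega> [0..<T]) / real T - s T / real T\<bar> \<le> e"
proof -
  have "\<forall>\<^sub>F T in sequentially. D / real T < e"
    by (rule order_tendstoD(2)[OF lim_const_over_n]) (rule \<open>0 < e\<close>)
  then show ?thesis
  proof eventually_elim
    case (elim T)
    have "\<bar>history_sum f (map \<omega> [0..<T]) / real T - s T / real T\<bar> \<le> D / real T"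
      using D[of T] by (simp add: diff_divide_distrib[symmetric] divide_right_mono)
    then show ?case using elim by simp
  qed
qed

text \<open>
  Almost surely the average exceeds \<open>v - e\<close> eventually, for every \<open>e > 0\<close>; this bounds the lower limit pointwise.
\<close>

lemma payoff_ge:
  fixes A :: "real^'n::finite^'m::finite"
  assumes drift: "\<And>h. v \<le> measure_pmf.expectation (stage_pmf \<sigma> \<tau> h) (potential_payoff A S c j0 w h)"
  shows "v \<le> payoff A S c \<sigma> \<tau>"
proof -
  interpret prob_space "play_measure \<sigma> \<tau>" by (rule prob_space_play_measure)
  let ?f = "potential_payoff A S c j0 w"
  obtain B D where B: "\<And>h a. \<bar>?f h a\<bar> \<le> B"
    and D: "\<And>\<omega> T. \<bar>history_sum ?f (map \<omega> [0..<T]) - (\<Sum>t<T. stage_payoff A S c \<omega> t)\<bar> \<le> D"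
    by (rule potential_payoff_bounds[of A S c j0 w]) blast
  have "AE \<omega> in play_measure \<sigma> \<tau>. v \<le> liminf_average A S c \<omega>"
    using AE_average_ge[OF B drift]
  proof eventually_elim
    case (elim \<omega>)
    obtain l where L: "liminf (\<lambda>T. ereal ((\<Sum>t<T. stage_payoff A S c \<omega> t) / real T)) = ereal l"
      and l: "liminf_average A S c \<omega> = l" by (rule liminf_average_real_liminf)
    have "v \<le> l + e" if "0 < e" for e
    proof -
      have e2: "0 < e / 2" using that by simp
      have "\<forall>\<^sub>F T in sequentially. ereal (v - e) \<le> ereal ((\<Sum>t<T. stage_payoff A S c \<omega> t) / real T)"
        using elim[rule_format, OF e2] history_average_close[OF D e2, of \<omega>]
      proof eventually_elim
        case (elim T)
        then have "v - e \<le> (\<Sum>t<T. stage_payoff A S c \<omega> t) / real T" by linarith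
        then show ?case by simp
      qed
      then have "ereal (v - e) \<le> ereal l" unfolding L[symmetric] by (rule Liminf_bounded)
      then show ?thesis by simp
    qed
    then show ?case unfolding l by (rule field_le_epsilon)
  qed
  then show ?thesis
    unfolding payoff_def by (intro integral_ge_const integrable_liminf_average)
qed

text \<open>
  The law for averages is applied to the negated payoffs.  It bounds the upper limit, and thus the lower limit.
\<close>

lemma payoff_le:
  fixes A :: "real^'n::finite^'m::finite"
  assumes drift: "\<And>h. measure_pmf.expectation (stage_pmf \<sigma> \<tau> h) (potential_payoff A S c j0 w h) \<le> v"
  shows "payoff A S c \<sigma> \<tau> \<le> v"
proof -
  interpret prob_space "play_measure \<sigma> \<tau>" by (rule prob_space_play_measure)
  let ?f = "potential_payoff A S c j0 w"
  obtain B D where B: "\<And>h a. \<bar>?f h a\<bar> \<le> B"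
    and D: "\<And>\<omega> T. \<bar>history_sum ?f (map \<omega> [0..<T]) - (\<Sum>t<T. stage_payoff A S c \<omega> t)\<bar> \<le> D"
    by (rule potential_payoff_bounds[of A S c j0 w]) blast
  have "AE \<omega> in play_measure \<sigma> \<tau>. \<forall>e>0. \<forall>\<^sub>F T in sequentially.
      - v - e \<le> history_sum (\<lambda>h a. - ?f h a) (map \<omega> [0..<T]) / real T"
    by (rule AE_average_ge[where B = B]) (use B drift in auto)
  then have "AE \<omega> in play_measure \<sigma> \<tau>. liminf_average A S c \<omega> \<le> v"
  proof eventually_elim
    case (elim \<omega>)
    obtain l where L: "liminf (\<lambda>T. ereal ((\<Sum>t<T. stage_payoff A S c \<omega> t) / real T)) = ereal l"
      and l: "liminf_average A S c \<omega> = l" by (rule liminf_average_real_liminf)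
    have neg: "history_sum (\<lambda>h a. - ?f h a) h = - history_sum ?f h" for h
      by (simp add: history_sum_def sum_negf)
    have "l \<le> v + e" if "0 < e" for e
    proof -
      have e2: "0 < e / 2" using that by simp
      have "\<forall>\<^sub>F T in sequentially. ereal ((\<Sum>t<T. stage_payoff A S c \<omega> t) / real T) \<le> ereal (v + e)"
        using elim[rule_format, OF e2] history_average_close[OF D e2, of \<omega>]
      proof eventually_elim
        case (elim T)
        then have "(\<Sum>t<T. stage_payoff A S c \<omega> t) / real T \<le> v + e"
          unfolding neg minus_divide_left[symmetric] by linarith
        then show ?case by simp
      qed
      then have "limsup (\<lambda>T. ereal ((\<Sum>t<T. stage_payoff A S c \<omega> t) / real T)) \<le> ereal (v + e)"
        by (rule Limsup_bounded)
      then have "ereal l \<le> ereal (v + e)"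
        unfolding L[symmetric] by (rule order_trans[OF Liminf_le_Limsup, rotated]) simp
      then show ?thesis by simp
    qed
    then show ?case unfolding l by (rule field_le_epsilon)
  qed
  then show ?thesis
    unfolding payoff_def by (intro integral_le_const integrable_liminf_average)
qed

section \<open>Optimal stationary strategies\<close>

lemma expectation_pair_pmf_finite:
  fixes p :: "'a::finite pmf" and q :: "'b::finite pmf" and f :: "'a \<times> 'b \<Rightarrow> real"
  shows "measure_pmf.expectation (pair_pmf p q) f = (\<Sum>i\<in>UNIV. \<Sum>j\<in>UNIV. pmf p i * pmf q j * f (i, j))"
  by (simp add: integral_measure_pmf[of UNIV] sum_UNIV_prod pmf_pair)

lemma weighted_average_bounds:
  fixes p :: "'a::finite pmf"
  shows "(\<And>i. v \<le> f i) \<Longrightarrow> v \<le> (\<Sum>i\<in>UNIV. pmf p i * f i)"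
    and "(\<And>i. f i \<le> v) \<Longrightarrow> (\<Sum>i\<in>UNIV. pmf p i * f i) \<le> v"
proof -
  have v: "(\<Sum>i\<in>UNIV. pmf p i * v) = v"
    by (simp add: sum_distrib_right[symmetric] sum_pmf_UNIV)
  show "v \<le> (\<Sum>i\<in>UNIV. pmf p i * f i)" if "\<And>i. v \<le> f i"
    using sum_mono[of UNIV "\<lambda>i. pmf p i * v" "\<lambda>i. pmf p i * f i"] that v by (simp add: mult_left_mono)
  show "(\<Sum>i\<in>UNIV. pmf p i * f i) \<le> v" if "\<And>i. f i \<le> v"
    using sum_mono[of UNIV "\<lambda>i. pmf p i * f i" "\<lambda>i. pmf p i * v"] that v by (simp add: mult_left_mono)
qed

text \<open>
  Whatever row is played in state \<open>k\<close>, the expected payoff is at most \<^const>\<open>state_cost\<close>, so the potential of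
  \<open>policy_potential\<close> bounds the drift after every history.
\<close>

lemma policy_guarantees:
  fixes A :: "real^'n::finite^'m::finite" and \<sigma> :: "('m, 'n) strategy1"
  assumes x: "x \<in> flows" and min: "\<And>x'. x' \<in> flows \<Longrightarrow> flow_cost A S c x \<le> flow_cost A S c x'"
    and z: "follows_flow x z"
  shows "payoff A S c \<sigma> (\<lambda>h. z (previous_column j0 h)) \<le> flow_cost A S c x"
proof (rule field_le_epsilon)
  fix e :: real assume "0 < e"
  then obtain h where h: "\<And>k. state_cost A S c z k + (\<Sum>j\<in>UNIV. pmf (z k) j * h j) - h k \<le> flow_cost A S c x + e"
    using policy_potential[OF x min z, of "flow_cost A S c x + e"] by auto
  show "payoff A S c \<sigma> (\<lambda>h. z (previous_column j0 h)) \<le> flow_cost A S c x + e"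
  proof (rule payoff_le[where w = h and ?j0.0 = j0])
    fix H :: "('m, 'n) history"
    define k where "k = previous_column j0 H"
    have "(\<Sum>j\<in>UNIV. pmf (z k) j * (A $ i $ j + c * S $ k $ j + h j - h k)) \<le> flow_cost A S c x + e" for i
    proof -
      have "(\<Sum>j\<in>UNIV. pmf (z k) j * h k) = h k"
        by (simp add: sum_distrib_right[symmetric] sum_pmf_UNIV)
      then have "(\<Sum>j\<in>UNIV. pmf (z k) j * (A $ i $ j + c * S $ k $ j + h j - h k)) =
          (\<Sum>j\<in>UNIV. pmf (z k) j * A $ i $ j) + c * (\<Sum>j\<in>UNIV. pmf (z k) j * S $ k $ j)
          + (\<Sum>j\<in>UNIV. pmf (z k) j * h j) - h k"
        by (simp add: distrib_left right_diff_distrib sum.distrib sum_subtractf sum_distrib_left mult.left_commute)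
      moreover have "(\<Sum>j\<in>UNIV. pmf (z k) j * A $ i $ j) \<le> (MAX i. \<Sum>j\<in>UNIV. pmf (z k) j * A $ i $ j)"
        by (rule Max_ge) auto
      ultimately show ?thesis using h[of k] unfolding state_cost_def by linarith
    qed
    then have "(\<Sum>i\<in>UNIV. pmf (\<sigma> H) i * (\<Sum>j\<in>UNIV. pmf (z k) j * (A $ i $ j + c * S $ k $ j + h j - h k)))
        \<le> flow_cost A S c x + e"
      by (rule weighted_average_bounds(2))
    then show "measure_pmf.expectation (stage_pmf \<sigma> (\<lambda>h. z (previous_column j0 h)) H)
        (potential_payoff A S c j0 h H) \<le> flow_cost A S c x + e"
      by (simp add: expectation_pair_pmf_finite potential_payoff_def k_def sum_distrib_left mult.assoc)
  qed
qed

text \<open>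
  Player 1 plays the mixed actions of the dual solution.  They bound the drift from below for each column, hence
  for every mixed action of Player 2.
\<close>

lemma maximizer_guarantees:
  fixes A :: "real^'n::finite^'m::finite"
  assumes "\<And>x. x \<in> flows \<Longrightarrow> v < flow_cost A S c x"
  shows "\<exists>\<sigma> :: ('m, 'n) strategy1. \<forall>\<tau>. v \<le> payoff A S c \<sigma> \<tau>"
proof -
  obtain y :: "'n \<Rightarrow> 'm pmf" and w
    where yw: "\<And>k j. v \<le> (\<Sum>i\<in>UNIV. pmf (y k) i * A $ i $ j) + c * S $ k $ j + w j - w k"
    using flow_dual_potential[OF assms] by blast
  have "v \<le> payoff A S c (\<lambda>h. y (previous_column undefined h)) \<tau>" for \<tau> :: "('m, 'n) strategy2"
  proof (rule payoff_ge[where w = w and ?j0.0 = undefined])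
    fix H :: "('m, 'n) history"
    define k where "k = previous_column undefined H"
    have mean: "(\<Sum>i\<in>UNIV. pmf (y k) i * (A $ i $ j + c * S $ k $ j + w j - w k)) =
        (\<Sum>i\<in>UNIV. pmf (y k) i * A $ i $ j) + c * S $ k $ j + w j - w k" for j
      by (simp add: distrib_left right_diff_distrib sum.distrib sum_subtractf
          sum_distrib_right[symmetric] sum_pmf_UNIV)
    have "v \<le> (\<Sum>j\<in>UNIV. pmf (\<tau> H) j * (\<Sum>i\<in>UNIV. pmf (y k) i * (A $ i $ j + c * S $ k $ j + w j - w k)))"
      by (rule weighted_average_bounds(1)) (simp only: mean yw)
    also have "\<dots> = measure_pmf.expectation (stage_pmf (\<lambda>h. y (previous_column undefined h)) \<tau> H)
        (potential_payoff A S c undefined w H)"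
      unfolding expectation_pair_pmf_finite
      by (subst sum.swap) (simp add: potential_payoff_def k_def sum_distrib_left mult_ac)
    finally show "v \<le> measure_pmf.expectation (stage_pmf (\<lambda>h. y (previous_column undefined h)) \<tau> H)
        (potential_payoff A S c undefined w H)" .
  qed
  then show ?thesis by blast
qed

text \<open>
  One strategy of Player 2 that guarantees \<open>V\<close> meets strategies of Player 1 that guarantee every smaller
  \<open>v\<close>.  The suprema and infima are over bounded sets of reals, so they are not default values.
\<close>

lemma has_valueI:
  fixes A :: "real^'n::finite^'m::finite"
  assumes upper: "\<And>\<sigma>. payoff A S c \<sigma> \<tau> \<le> V"
    and lower: "\<And>v. v < V \<Longrightarrow> \<exists>\<sigma>. \<forall>\<tau>. v \<le> payoff A S c \<sigma> \<tau>"
  shows "has_value A S c V"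
proof -
  let ?p = "payoff A S c"
  obtain B where B: "\<And>\<sigma> \<tau>. \<bar>?p \<sigma> \<tau>\<bar> \<le> B" using payoff_bounded[of A S c] by blast
  have below: "bdd_below (range (\<lambda>\<tau>. ?p \<sigma> \<tau>))" and above: "bdd_above (range (\<lambda>\<sigma>. ?p \<sigma> \<tau>))" for \<sigma> \<tau>
    using B by (auto intro!: bdd_belowI[of _ "- B"] bdd_aboveI[of _ B] simp: abs_le_iff minus_le_iff)
  have INF_le: "(INF \<tau>. ?p \<sigma> \<tau>) \<le> V" for \<sigma>
    using cINF_lower[OF below, of \<tau> \<sigma>] upper[of \<sigma>] by simp
  have "v \<le> (SUP \<sigma>. INF \<tau>. ?p \<sigma> \<tau>)" and "v \<le> (INF \<tau>. SUP \<sigma>. ?p \<sigma> \<tau>)" if v: "v < V" for v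
  proof -
    obtain \<sigma> where \<sigma>: "\<And>\<tau>. v \<le> ?p \<sigma> \<tau>" using lower[OF v] by blast
    have "v \<le> (INF \<tau>. ?p \<sigma> \<tau>)" by (rule cINF_greatest) (auto simp: \<sigma>)
    also have "\<dots> \<le> (SUP \<sigma>. INF \<tau>. ?p \<sigma> \<tau>)"
      by (rule cSUP_upper) (auto intro!: bdd_aboveI[of _ V] INF_le)
    finally show "v \<le> (SUP \<sigma>. INF \<tau>. ?p \<sigma> \<tau>)" .
    show "v \<le> (INF \<tau>. SUP \<sigma>. ?p \<sigma> \<tau>)"
      by (rule cINF_greatest) (auto intro: order_trans[OF \<sigma> cSUP_upper[OF _ above]])
  qed
  then have "V \<le> (SUP \<sigma>. INF \<tau>. ?p \<sigma> \<tau>)" "V \<le> (INF \<tau>. SUP \<sigma>. ?p \<sigma> \<tau>)"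
    by (blast intro: dense_le)+
  moreover have "(SUP \<sigma>. INF \<tau>. ?p \<sigma> \<tau>) \<le> V" by (rule cSUP_least) (auto intro: INF_le)
  moreover have "(INF \<tau>. SUP \<sigma>. ?p \<sigma> \<tau>) \<le> V"
  proof -
    have "- B \<le> (SUP \<sigma>. ?p \<sigma> \<tau>)" for \<tau>
      using cSUP_upper[OF _ above, of undefined \<tau>] B[of undefined \<tau>] by (simp add: abs_le_iff)
    then have "(INF \<tau>. SUP \<sigma>. ?p \<sigma> \<tau>) \<le> (SUP \<sigma>. ?p \<sigma> \<tau>)"
      by (intro cINF_lower) (auto intro!: bdd_belowI[of _ "- B"])
    also have "\<dots> \<le> V" by (rule cSUP_least) (auto intro: upper)
    finally show ?thesis .
  qed
  ultimately show ?thesis by (simp add: has_value_def)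
qed

lemma optimal2_if_optimal_flow:
  fixes A :: "real^'n::finite^'m::finite"
  assumes x: "x \<in> flows" and min: "\<And>x'. x' \<in> flows \<Longrightarrow> flow_cost A S c x \<le> flow_cost A S c x'"
    and z: "follows_flow x z"
  shows "optimal2 A S c (\<lambda>h. z (previous_column j0 h))"
proof -
  have upper: "payoff A S c \<sigma> (\<lambda>h. z (previous_column j0 h)) \<le> flow_cost A S c x" for \<sigma> :: "('m, 'n) strategy1"
    by (rule policy_guarantees[OF assms])
  have "\<exists>\<sigma> :: ('m, 'n) strategy1. \<forall>\<tau>. v \<le> payoff A S c \<sigma> \<tau>" if "v < flow_cost A S c x" for v
    by (rule maximizer_guarantees) (use min that in force)
  with upper have "has_value A S c (flow_cost A S c x)" by (rule has_valueI)
  then show ?thesis using upper by (auto simp: optimal2_def)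
qed

theorem corollary1:
  fixes A :: "real^'n^'m" and S :: "real^'n^'n" and j0 :: 'n
  assumes "switching_cost_matrix S"
  shows "\<exists>(K::nat) (c :: nat \<Rightarrow> ereal).
           c 0 = 0 \<and> c (K + 1) = \<infinity> \<and> (\<forall>i\<le>K. c i < c (i + 1)) \<and>
           (\<forall>i\<le>K. \<exists>\<tau> :: ('m, 'n) strategy2. stationary j0 \<tau> \<and>
              (\<forall>x::real. c i \<le> ereal x \<and> ereal x \<le> c (i + 1) \<longrightarrow> optimal2 A S x \<tau>))"
proof -
  obtain E where "E \<subseteq> flows" "finite E" "E \<noteq> {}"
    and E: "\<And>c x. x \<in> flows \<Longrightarrow> \<exists>e\<in>E. flow_cost A S c e \<le> flow_cost A S c x"
    using finite_optimal_flows[of A S] by blast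
  obtain K and c :: "nat \<Rightarrow> ereal" where c: "c 0 = 0" "c (K + 1) = \<infinity>" "\<forall>i\<le>K. c i < c (i + 1)"
    and env: "\<And>i. i \<le> K \<Longrightarrow> \<exists>e\<in>E. \<forall>x::real. c i \<le> ereal x \<and> ereal x \<le> c (i + 1) \<longrightarrow>
      (\<forall>e'\<in>E. matrix_cost A e + x * switching_rate S e \<le> matrix_cost A e' + x * switching_rate S e')"
    using exists_lower_envelope_breakpoints[OF \<open>finite E\<close> \<open>E \<noteq> {}\<close>, of "matrix_cost A" "switching_rate S"] by blast
  have "\<exists>\<tau> :: ('m, 'n) strategy2. stationary j0 \<tau> \<and>
      (\<forall>x::real. c i \<le> ereal x \<and> ereal x \<le> c (i + 1) \<longrightarrow> optimal2 A S x \<tau>)" if "i \<le> K" for i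
  proof -
    obtain e where "e \<in> E" and e: "\<And>x e'. c i \<le> ereal x \<Longrightarrow> ereal x \<le> c (i + 1) \<Longrightarrow> e' \<in> E \<Longrightarrow>
        flow_cost A S x e \<le> flow_cost A S x e'"
      using env[OF \<open>i \<le> K\<close>] unfolding flow_cost_def by blast
    then have "e \<in> flows" using \<open>E \<subseteq> flows\<close> by blast
    then obtain z where z: "follows_flow e z" using exists_follows_flow by blast
    have "optimal2 A S x (\<lambda>h :: ('m, 'n) history. z (previous_column j0 h))"
      if "c i \<le> ereal x" "ereal x \<le> c (i + 1)" for x
    proof (rule optimal2_if_optimal_flow[OF \<open>e \<in> flows\<close> _ z])
      fix x' :: "real^('n \<times> 'n)" assume "x' \<in> flows"
      then show "flow_cost A S x e \<le> flow_cost A S x x'"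
        using E[of x' x] e[OF that] order_trans by blast
    qed
    moreover have "stationary j0 (\<lambda>h :: ('m, 'n) history. z (previous_column j0 h))"
      by (auto simp: stationary_def)
    ultimately show ?thesis by blast
  qed
  with c show ?thesis by blast
qed

end
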